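(* Let $\mu,\nu\in\mathcal P_2^{\rm ac}(\mathbb R^d)$, and assume that there is a convex function $\varphi\in C^2(\mathbb R^d)$ and constants $0<\sigma_m(\varphi)\le\sigma_M(\varphi)<\infty$ such that $(\nabla\varphi)_\#\mu=\nu$ and $\sigma_m(\varphi)I\preceq\nabla^2\varphi(y)\preceq\sigma_M(\varphi)I$ for all $y\in\mathbb R^d$. Assume moreover that $\mu,\nu\in\mathcal P_{2+\beta}(\mathbb R^d)$ for some $\beta>0$ and that $$\int|\log f_\mu|\,d\mu+\int|\log f_\nu|\,d\nu<\infty.$$ Then, for every fixed $\varepsilon>0$, $$\lim_{p\to1^+}\left\{\left(\frac{\varepsilon}{p-1}\right)^{\frac{2}{d(p-1)+2}}\mathfrak C_{d,p}\,\mathcal K(\mu,\nu,p)-\frac{\varepsilon}{p-1}\right\}=-\frac d2\,\varepsilon\log(\pi\varepsilon)+\varepsilon\,\mathcal K_{\rm EOT}(\mu,\nu).$$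
   Context: For $q>0$, $\mathcal P_q(\mathbb R^d)$ is the set of Borel probability measures on $\mathbb R^d$ with finite $q$-th moment, and $\mathcal P_q^{\rm ac}(\mathbb R^d)$ the subset of those absolutely continuous with respect to Lebesgue measure; $f_\mu$ denotes the Lebesgue density of $\mu$. Define, for $p>1$, $$\mathcal K(\mu,\nu,p)=\int\left[f_\nu(\nabla\varphi(x))f_\mu(x)\right]^{-\frac{p-1}{d(p-1)+2}}d\mu(x),$$ $$\mathfrak B_{d,p}=\frac{p^{d/2}}{2}\,\omega_{d-1}\,B\!\left(\frac{p}{p-1},\frac d2\right),\qquad \mathfrak C_{d,p}=\frac{p(d(p-1)+2)}{d(p-1)+2p}\,\mathfrak B_{d,p}^{-\frac{2(p-1)}{d(p-1)+2}},$$ where $\omega_{d-1}$ is the $(d-1)$-dimensional Hausdorff measure of the unit sphere $\mathbb S^{d-1}\subset\mathbb R^d$ and $B(\cdot,\cdot)$ is the beta function. Also $$\mathcal K_{\rm EOT}(\mu,\nu)=-\frac12\int_{\mathbb R^d}\log\left[f_\mu(x)f_\nu(\nabla\varphi(x))\right]d\mu(x)=-\frac12\left(\int\log f_\mu\,d\mu+\int\log f_\nu\,d\nu\right).$$ *)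

theory Defs
  imports "HOL-Probability.Probability"
begin

section \<open>Gradient, Hessian and the Loewner order\<close>

text \<open>The gradient is meaningful only at points of differentiability.\<close>

definition grad :: "('a::real_inner \<Rightarrow> real) \<Rightarrow> 'a \<Rightarrow> 'a" where
  "grad f x = (THE g. GDERIV f x :> g)"

definition hessian :: "(real^'n \<Rightarrow> real) \<Rightarrow> real^'n \<Rightarrow> real^'n^'n" where
  "hessian f x = jacobian (grad f) (at x)"

definition C2 :: "(real^'n \<Rightarrow> real) \<Rightarrow> bool" where
  "C2 f \<longleftrightarrow> (\<forall>x. f differentiable (at x)) \<and> (\<forall>x. grad f differentiable (at x)) \<and>
     continuous_on UNIV (hessian f)"

text \<open>Symmetry of the difference is not part of the definition: the order is only used for
  Hessians of \<open>C\<^sup>2\<close> functions and multiples of the identity, which are symmetric.\<close>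

definition loewner_le :: "real^'n^'n \<Rightarrow> real^'n^'n \<Rightarrow> bool" (infix \<open>\<preceq>\<close> 50) where
  "A \<preceq> B \<longleftrightarrow> (\<forall>v. 0 \<le> v \<bullet> ((B - A) *v v))"


section \<open>Probability measures with moments and densities\<close>

definition prob_moment :: "real \<Rightarrow> (real^'n) measure set" where
  "prob_moment q = {\<mu>. prob_space \<mu> \<and> sets \<mu> = sets borel \<and>
     (\<integral>\<^sup>+ x. ennreal (norm x powr q) \<partial>\<mu>) < \<infinity>}"

definition prob_moment_ac :: "real \<Rightarrow> (real^'n) measure set" where
  "prob_moment_ac q = {\<mu> \<in> prob_moment q. absolutely_continuous lborel \<mu>}"

definition lebesgue_density :: "(real^'n) measure \<Rightarrow> real^'n \<Rightarrow> real" where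
  "lebesgue_density \<mu> x = enn2real (RN_deriv lborel \<mu> x)"


section \<open>Hausdorff measure\<close>

text \<open>The Hausdorff (outer) measure of integer dimension \<open>k\<close>, normalised by the volume of the
  \<open>k\<close>-dimensional unit ball so that it agrees with Lebesgue measure on \<open>k\<close>-planes.
  The empty set is treated separately because its diameter is \<open>0\<close> and \<open>0 ^ 0 = 1\<close>;
  boundedness is required because \<^const>\<open>diameter\<close> is unspecified on unbounded sets.\<close>

definition hausdorff_gauge :: "nat \<Rightarrow> 'a::metric_space set \<Rightarrow> ennreal" where
  "hausdorff_gauge k U =
     (if U = {} then 0 else ennreal (unit_ball_vol (real k) * (diameter U / 2) ^ k))"

definition hausdorff_content :: "real \<Rightarrow> nat \<Rightarrow> 'a::metric_space set \<Rightarrow> ennreal" where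
  "hausdorff_content \<delta> k A =
     (INF U \<in> {U :: nat \<Rightarrow> 'a set. A \<subseteq> (\<Union>i. U i) \<and> (\<forall>i. bounded (U i) \<and> diameter (U i) \<le> \<delta>)}.
        \<Sum>i. hausdorff_gauge k (U i))"

definition hausdorff_measure :: "nat \<Rightarrow> 'a::metric_space set \<Rightarrow> ennreal" where
  "hausdorff_measure k A = (SUP \<delta> \<in> {0<..}. hausdorff_content \<delta> k A)"


section \<open>The constants and functionals\<close>

text \<open>The dimension \<open>d\<close> enters through the type \<^typ>\<open>real^'n\<close>, passed as \<open>TYPE('n)\<close>.\<close>

definition sphere_area :: "'n::finite itself \<Rightarrow> real" where
  "sphere_area _ = enn2real (hausdorff_measure (CARD('n) - 1) (sphere (0 :: real^'n) 1))"

definition frakB :: "'n::finite itself \<Rightarrow> real \<Rightarrow> real" where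
  "frakB T p = (let d = real CARD('n) in
     p powr (d / 2) / 2 * sphere_area T * Beta (p / (p - 1)) (d / 2))"

definition frakC :: "'n::finite itself \<Rightarrow> real \<Rightarrow> real" where
  "frakC T p = (let d = real CARD('n) in
     p * (d * (p - 1) + 2) / (d * (p - 1) + 2 * p)
       * frakB T p powr (- (2 * (p - 1) / (d * (p - 1) + 2))))"

text \<open>In both functionals \<open>\<phi>\<close> is the potential whose gradient pushes \<open>\<mu>\<close> to \<open>\<nu>\<close>.
  The first is the integral of a nonnegative function and may a priori be infinite, hence
  extended-valued. The conventions \<open>0 powr a = 0\<close> and \<open>ln 0 = 0\<close> are immaterial, as both
  densities in the integrands are positive \<open>\<mu>\<close>-almost everywhere.\<close>

definition cost_K ::
  "(real^'n \<Rightarrow> real) \<Rightarrow> (real^'n) measure \<Rightarrow> (real^'n) measure \<Rightarrow> real \<Rightarrow> ennreal" where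
  "cost_K \<phi> \<mu> \<nu> p = (let d = real CARD('n) in
     \<integral>\<^sup>+ x. ennreal ((lebesgue_density \<nu> (grad \<phi> x) * lebesgue_density \<mu> x)
               powr (- ((p - 1) / (d * (p - 1) + 2)))) \<partial>\<mu>)"

definition K_EOT ::
  "(real^'n \<Rightarrow> real) \<Rightarrow> (real^'n) measure \<Rightarrow> (real^'n) measure \<Rightarrow> real" where
  "K_EOT \<phi> \<mu> \<nu> =
     - 1 / 2 * (\<integral> x. ln (lebesgue_density \<mu> x * lebesgue_density \<nu> (grad \<phi> x)) \<partial>\<mu>)"

end

theory Submission
  imports Defs "HOL-Real_Asymp.Real_Asymp"
begin

text \<open>
  Write \<open>p = 1 + h\<close>, \<open>d\<close> for the dimension and \<open>L = ln (f\<^sub>\<mu> \<cdot> f\<^sub>\<nu> \<circ> \<nabla>\<phi>)\<close>. The transport cost is the exponential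
  moment \<open>\<integral> exp (- a L) d\<mu>\<close> with \<open>a = h / (d h + 2)\<close>. It is finite for small \<open>a\<close> because the second
  moments make small negative powers of the densities integrable, and by dominated convergence it equals
  \<open>1 + h (K\<^sub>E\<^sub>O\<^sub>T + o(1))\<close>. Log-convexity of the Gamma function gives the asymptotics of the beta function,
  so that the prefactor is \<open>\<epsilon> / h \<cdot> exp (h w)\<close> with \<open>w \<rightarrow> - d / 2 \<cdot> ln (\<pi> \<epsilon>)\<close>. In the difference the divergent
  terms \<open>\<epsilon> / h\<close> cancel and the first order terms remain.

  The limit of \<open>w\<close> depends on the exact Hausdorff measure of the sphere. Measure a subset of the sphere by
  \<open>d\<close> times the volume of the solid cone over it. By a gnomonic projection and the isodiametric inequality
  (Steiner symmetrization, carried out on the cone itself so that no space of dimension \<open>d - 1\<close> is needed)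
  this is at most the Hausdorff gauge of the subset, up to a factor tending to \<open>1\<close> with the
  diameter. For small spherical caps the two nearly agree, and Vitali's covering lemma transfers this to an
  upper bound for the Hausdorff measure of the whole sphere.
\<close>

section \<open>Steiner symmetrization and an isodiametric inequality\<close>

text \<open>The factor \<epsilon> / h magnifies every relative error of order h to order one, so a
  wrong multiplicative constant in the area of the sphere would already shift the limit. Both bounds
  for the Hausdorff measure must therefore be sharp. In the lower bound a covering set is known only
  through its diameter, and enclosing it in a ball with that diameter as radius loses a factor
  2^(d-1); this is what forces an isodiametric inequality. In the upper bound Vitali's lemma alone
  loses 5^(d-1). It is used only to find finitely many disjoint caps that fill a fixed fraction of a
  relatively open piece of the sphere. These caps are charged nearly their true area and the rest is
  again relatively open, so a bound valid for all open pieces improves itself and its excess decays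
  geometrically. In the prefactor, the powers of \<epsilon> / h and of the beta function both
  contribute terms h ln h to the logarithm; these would diverge after division by h and have to
  cancel exactly.\<close>

lemma nn_integral_lborel_translate:
  fixes g :: "'a::euclidean_space \<Rightarrow> ennreal"
  assumes [measurable]: "g \<in> borel_measurable borel"
  shows "(\<integral>\<^sup>+x. g (x + t) \<partial>lborel) = (\<integral>\<^sup>+x. g x \<partial>lborel)"
proof -
  have "(\<integral>\<^sup>+x. g x \<partial>lborel) = (\<integral>\<^sup>+x. g x \<partial>distr lborel borel ((+) t))"
    by (simp add: lborel_distr_plus)
  also have "\<dots> = (\<integral>\<^sup>+x. g (x + t) \<partial>lborel)"
    by (subst nn_integral_distr) (auto simp: add.commute)
  finally show ?thesis by simp
qed

lemma nn_integral_lborel_reflect: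
  fixes g :: "'a::euclidean_space \<Rightarrow> ennreal"
  assumes [measurable]: "g \<in> borel_measurable borel"
  shows "(\<integral>\<^sup>+x. g (t - x) \<partial>lborel) = (\<integral>\<^sup>+x. g x \<partial>lborel)"
proof -
  have "(\<integral>\<^sup>+x. g x \<partial>lborel)
      = (\<integral>\<^sup>+x. g x \<partial>density (distr lborel borel (\<lambda>x. t + (-1) *\<^sub>R x)) (\<lambda>_. \<bar>-1::real\<bar>^DIM('a)))"
    by (subst lborel_affine[of "-1" t]) auto
  also have "\<dots> = (\<integral>\<^sup>+x. g (t - x) \<partial>lborel)"
    by (simp add: density_1 nn_integral_distr)
  finally show ?thesis by simp
qed

text \<open>Both measures are translation invariant and \<open>\<sigma>\<close>-finite, hence proportional by Fubini;
  the unit ball fixes the factor.\<close>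

lemma lborel_distr_linear_isometry:
  fixes f :: "'a::euclidean_space \<Rightarrow> 'a"
  assumes lin: "linear f" and iso: "\<And>x. norm (f x) = norm x"
  shows "distr lborel borel f = lborel"
proof -
  have inj: "inj f"
    by (metis lin iso linear_injective_0 norm_eq_zero)
  then have surj: "surj f"
    using lin linear_injective_imp_surjective by blast
  have f[measurable]: "f \<in> borel_measurable borel"
    using lin by (intro borel_measurable_continuous_onI linear_continuous_on) (simp add: linear_linear)
  define M where "M = distr lborel borel f"
  have sM[simp, measurable_cong]: "sets M = sets borel" and [simp]: "space M = UNIV"
    by (auto simp: M_def)
  have ball: "emeasure M (ball 0 r) = emeasure lborel (ball (0::'a) r)" for r
  proof -
    have "f -` ball 0 r = ball 0 r" by (auto simp: iso)
    then show ?thesis by (simp add: M_def emeasure_distr)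
  qed
  have "sigma_finite_measure M"
  proof
    have "(\<Union>n::nat. ball 0 (real n)) = (UNIV :: 'a set)"
      by (auto simp: reals_Archimedean2)
    then show "\<exists>A. countable A \<and> A \<subseteq> sets M \<and> \<Union> A = space M \<and> (\<forall>a\<in>A. emeasure M a \<noteq> \<infinity>)"
      by (intro exI[of _ "range (\<lambda>n::nat. ball 0 (real n))"]) (auto simp: ball emeasure_ball)
  qed
  then interpret M: sigma_finite_measure M .
  interpret MM: pair_sigma_finite M "lborel :: 'a measure"
    by (simp add: pair_sigma_finite_def M.sigma_finite_measure_axioms lborel.sigma_finite_measure_axioms)
  have transl: "(\<integral>\<^sup>+x. g (x - y) \<partial>M) = (\<integral>\<^sup>+x. g x \<partial>M)"
    if [measurable]: "g \<in> borel_measurable borel" for g :: "'a \<Rightarrow> ennreal" and y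
  proof -
    obtain s where s: "y = f s" using surj by (metis surjD)
    have "(\<integral>\<^sup>+x. g (x - y) \<partial>M) = (\<integral>\<^sup>+x. g (f (x + (- s))) \<partial>lborel)"
      by (simp add: M_def nn_integral_distr s linear_diff[OF lin])
    also have "\<dots> = (\<integral>\<^sup>+x. g x \<partial>M)"
      by (subst nn_integral_lborel_translate) (simp_all add: M_def nn_integral_distr)
    finally show ?thesis .
  qed
  \<comment> \<open>Fubini for the indicator of x in A and y + x in B: integrating over y first
    gives the left side. Replacing x by x - y, by the invariance of \<open>M\<close>, and then
    reflecting y gives the right side.\<close>
  have key: "emeasure M A * emeasure lborel B = emeasure M B * emeasure lborel A"
    if [measurable]: "A \<in> sets borel" "B \<in> sets borel" for A B
  proof -
    have "emeasure M A * emeasure lborel B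
        = (\<integral>\<^sup>+x. (\<integral>\<^sup>+y. indicator A x * indicator B (y + x) \<partial>lborel) \<partial>M)"
    proof -
      have "(\<integral>\<^sup>+y. indicator A x * indicator B (y + x) \<partial>lborel)
          = indicator A x * emeasure lborel B" for x :: 'a
        by (subst nn_integral_cmult)
           (simp_all add: nn_integral_lborel_translate[of "indicator B"])
      then show ?thesis by (simp add: nn_integral_multc)
    qed
    also have "\<dots> = (\<integral>\<^sup>+y. (\<integral>\<^sup>+x. indicator A x * indicator B (y + x) \<partial>M) \<partial>lborel)"
      by (rule MM.Fubini'[symmetric]) measurable
    also have "\<dots> = (\<integral>\<^sup>+y. (\<integral>\<^sup>+x. indicator A (x - y) * indicator B x \<partial>M) \<partial>lborel)"
    proof (rule nn_integral_cong)
      fix y :: 'a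
      show "(\<integral>\<^sup>+x. indicator A x * indicator B (y + x) \<partial>M)
          = (\<integral>\<^sup>+x. indicator A (x - y) * indicator B x \<partial>M)"
        using transl[of "\<lambda>x. indicator A x * indicator B (y + x)" y] by simp
    qed
    also have "\<dots> = (\<integral>\<^sup>+x. (\<integral>\<^sup>+y. indicator A (x - y) * indicator B x \<partial>lborel) \<partial>M)"
      by (rule MM.Fubini') measurable
    also have "\<dots> = emeasure M B * emeasure lborel A"
    proof -
      have "(\<integral>\<^sup>+y. indicator A (x - y) * indicator B x \<partial>lborel)
          = indicator B x * emeasure lborel A" for x :: 'a
        by (subst nn_integral_multc)
           (simp_all add: nn_integral_lborel_reflect[of "indicator A"] mult.commute)
      then show ?thesis by (simp add: nn_integral_multc)
    qed
    finally show ?thesis .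
  qed
  show ?thesis
    unfolding M_def[symmetric]
  proof (rule measure_eqI)
    fix A assume "A \<in> sets M"
    then have "emeasure lborel (ball (0::'a) 1) * emeasure M A = emeasure lborel (ball (0::'a) 1) * emeasure lborel A"
      using key[of A "ball 0 1"] by (simp add: ball mult.commute)
    moreover have "emeasure lborel (ball (0::'a) 1) \<noteq> 0" "emeasure lborel (ball (0::'a) 1) \<noteq> top"
      using unit_ball_vol_pos[of "DIM('a)"] by (auto simp: emeasure_ball simp del: unit_ball_vol_pos)
    ultimately show "emeasure M A = emeasure lborel A"
      unfolding ennreal_mult_cancel_left by blast
  qed simp
qed

lemma emeasure_lborel_vimage_linear_isometry:
  fixes f :: "'a::euclidean_space \<Rightarrow> 'a"
  assumes "linear f" "\<And>x. norm (f x) = norm x" "A \<in> sets borel"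
  shows "emeasure lborel (f -` A) = emeasure lborel A"
proof -
  have "f \<in> borel_measurable borel"
    using assms by (intro borel_measurable_continuous_onI linear_continuous_on) (simp add: linear_linear)
  then have "emeasure (distr lborel borel f) A = emeasure lborel (f -` A)"
    using assms by (subst emeasure_distr) auto
  then show ?thesis by (simp add: lborel_distr_linear_isometry assms)
qed

text \<open>Fubini in both orders. The inner integral over lines serves Steiner symmetrization,
  which rearranges each line separately; the outer one serves cone volumes, computed by height. The
  coordinate functions on \<open>Basis - {e}\<close> stand in for a space of one dimension
  less.\<close>

lemma nn_integral_lborel_slice:
  fixes e :: "'a::euclidean_space" and g :: "'a \<Rightarrow> ennreal"
  assumes e: "e \<in> Basis" and [measurable]: "g \<in> borel_measurable borel"
  defines "P \<equiv> \<Pi>\<^sub>M b\<in>Basis - {e}. (lborel :: real measure)"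
  defines "emb \<equiv> \<lambda>f t. (\<Sum>b\<in>Basis - {e}. f b *\<^sub>R b) + t *\<^sub>R e"
  shows "(\<integral>\<^sup>+x. g x \<partial>lborel) = (\<integral>\<^sup>+f. (\<integral>\<^sup>+t. g (emb f t) \<partial>lborel) \<partial>P)"
    and "(\<integral>\<^sup>+x. g x \<partial>lborel) = (\<integral>\<^sup>+t. (\<integral>\<^sup>+f. g (emb f t) \<partial>P) \<partial>lborel)"
proof -
  interpret product_sigma_finite "\<lambda>_::'a. lborel :: real measure" by standard
  have B: "insert e (Basis - {e}) = (Basis :: 'a set)" using e by auto
  have 1: "(\<integral>\<^sup>+x. g x \<partial>lborel)
      = (\<integral>\<^sup>+f. g (\<Sum>b\<in>Basis. f b *\<^sub>R b) \<partial>(\<Pi>\<^sub>M b\<in>insert e (Basis - {e}). lborel))"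
    unfolding B by (subst lborel_eq) (simp add: nn_integral_distr)
  have m: "(\<lambda>f. g (\<Sum>b\<in>Basis. f b *\<^sub>R b)) \<in> borel_measurable (\<Pi>\<^sub>M b\<in>insert e (Basis - {e}). lborel)"
    unfolding B by measurable
  have *: "(\<Sum>b\<in>Basis. (f(e := t)) b *\<^sub>R b) = emb f t" for f :: "'a \<Rightarrow> real" and t
  proof -
    have "(\<Sum>b\<in>insert e (Basis - {e}). (f(e := t)) b *\<^sub>R b)
        = t *\<^sub>R e + (\<Sum>b\<in>Basis - {e}. (f(e := t)) b *\<^sub>R b)"
      by (subst sum.insert) auto
    also have "(\<Sum>b\<in>Basis - {e}. (f(e := t)) b *\<^sub>R b) = (\<Sum>b\<in>Basis - {e}. f b *\<^sub>R b)"
      by (intro sum.cong) auto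
    finally show ?thesis unfolding B emb_def by (simp only: add.commute)
  qed
  show "(\<integral>\<^sup>+x. g x \<partial>lborel) = (\<integral>\<^sup>+f. (\<integral>\<^sup>+t. g (emb f t) \<partial>lborel) \<partial>P)"
    unfolding 1 P_def using product_nn_integral_insert[OF _ _ m] unfolding * by simp
  show "(\<integral>\<^sup>+x. g x \<partial>lborel) = (\<integral>\<^sup>+t. (\<integral>\<^sup>+f. g (emb f t) \<partial>P) \<partial>lborel)"
    unfolding 1 P_def using product_nn_integral_insert_rev[OF _ _ m] unfolding * by simp
qed

section \<open>Steiner symmetrization along a coordinate direction\<close>

definition fiber :: "'a::euclidean_space \<Rightarrow> 'a set \<Rightarrow> 'a \<Rightarrow> real set" where
  "fiber b A x = {t. x + (t - x \<bullet> b) *\<^sub>R b \<in> A}"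

text \<open>Steiner symmetrization. The strict inequality drops empty fibers without having to project
  \<open>A\<close>, which keeps the symmetrized set Borel.\<close>

definition steiner :: "'a::euclidean_space \<Rightarrow> 'a set \<Rightarrow> 'a set" where
  "steiner b A = {x. ennreal (2 * \<bar>x \<bullet> b\<bar>) < emeasure lborel (fiber b A x)}"

lemma fiber_borel [measurable]:
  assumes [measurable]: "A \<in> sets borel"
  shows "fiber b A x \<in> sets borel"
proof -
  have "(\<lambda>t. x + (t - x \<bullet> b) *\<^sub>R b) -` A \<inter> space borel \<in> sets borel"
    by (rule measurable_sets[OF _ assms]) measurable
  then show ?thesis by (simp add: fiber_def vimage_def)
qed

lemma fiber_cong:
  assumes "b \<in> Basis" "x - (x \<bullet> b) *\<^sub>R b = y - (y \<bullet> b) *\<^sub>R b"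
  shows "fiber b A x = fiber b A y"
proof -
  have "x + (t - x \<bullet> b) *\<^sub>R b = y + (t - y \<bullet> b) *\<^sub>R b" for t
  proof -
    have "x + (t - x \<bullet> b) *\<^sub>R b = (x - (x \<bullet> b) *\<^sub>R b) + t *\<^sub>R b"
      by (simp add: algebra_simps)
    also have "\<dots> = y + (t - y \<bullet> b) *\<^sub>R b" unfolding assms(2) by (simp add: algebra_simps)
    finally show ?thesis .
  qed
  then show ?thesis by (simp add: fiber_def)
qed

lemma fiber_shift:
  assumes "b \<in> Basis"
  shows "fiber b A (x + s *\<^sub>R b) = fiber b A x"
  using assms by (intro fiber_cong) (simp_all add: algebra_simps)

lemma steiner_borel [measurable]:
  assumes [measurable]: "A \<in> sets borel"
  shows "steiner b A \<in> sets borel"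
proof -
  have "emeasure lborel (fiber b A x) = (\<integral>\<^sup>+t. indicator A (x + (t - x \<bullet> b) *\<^sub>R b) \<partial>lborel)" for x
  proof -
    have "emeasure lborel (fiber b A x) = (\<integral>\<^sup>+t. indicator (fiber b A x) t \<partial>lborel)" by simp
    also have "\<dots> = (\<integral>\<^sup>+t. indicator A (x + (t - x \<bullet> b) *\<^sub>R b) \<partial>lborel)"
      by (intro nn_integral_cong) (auto simp: indicator_def fiber_def)
    finally show ?thesis .
  qed
  then have [measurable]: "(\<lambda>x. emeasure lborel (fiber b A x)) \<in> borel_measurable borel"
    by simp
  show ?thesis unfolding steiner_def by measurable
qed

text \<open>The reason why \<open>steiner\<close> preserves volume: a fiber of length
  \<open>L\<close> is exchanged for the centred open interval of that length, or for the whole line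
  if \<open>L\<close> is infinite.\<close>

lemma emeasure_lborel_abs_less:
  "emeasure lborel {t::real. ennreal (2 * \<bar>t\<bar>) < L} = L"
proof (cases L)
  case (real l)
  have "{t::real. ennreal (2 * \<bar>t\<bar>) < L} = {-(l/2)<..<l/2}"
    using real by (auto simp: ennreal_less_iff abs_less_iff)
  then show ?thesis using real by simp
next
  case top
  have "{t::real. ennreal (2 * \<bar>t\<bar>) < L} = UNIV" using top by auto
  then show ?thesis using top by simp
qed

lemma fiber_steiner:
  assumes "b \<in> Basis"
  shows "fiber b (steiner b A) x = {t. ennreal (2 * \<bar>t\<bar>) < emeasure lborel (fiber b A x)}"
proof -
  have "t \<in> fiber b (steiner b A) x \<longleftrightarrow> ennreal (2 * \<bar>t\<bar>) < emeasure lborel (fiber b A x)" for t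
    using assms fiber_shift[OF assms, of A x "t - x \<bullet> b"]
    unfolding fiber_def[of b "steiner b A"] by (simp add: steiner_def inner_add_left)
  then show ?thesis by blast
qed

lemma emeasure_steiner:
  fixes A :: "'a::euclidean_space set"
  assumes b: "b \<in> Basis" and [measurable]: "A \<in> sets borel"
  shows "emeasure lborel (steiner b A) = emeasure lborel A"
proof -
  let ?P = "\<Pi>\<^sub>M b\<in>Basis - {b}. (lborel :: real measure)"
  let ?x = "\<lambda>f. \<Sum>c\<in>Basis - {b}. f c *\<^sub>R c :: 'a"
  have *: "emeasure lborel B = (\<integral>\<^sup>+f. emeasure lborel (fiber b B (?x f)) \<partial>?P)"
    if [measurable]: "B \<in> sets borel" for B
  proof -
    have perp: "?x f \<bullet> b = 0" for f
      using b by (auto simp: inner_sum_left inner_Basis intro!: sum.neutral)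
    have "emeasure lborel B = (\<integral>\<^sup>+x. indicator B x \<partial>lborel)" by simp
    also have "\<dots> = (\<integral>\<^sup>+f. (\<integral>\<^sup>+t. indicator B (?x f + t *\<^sub>R b) \<partial>lborel) \<partial>?P)"
      by (rule nn_integral_lborel_slice(1)[OF b]) simp
    also have "\<dots> = (\<integral>\<^sup>+f. (\<integral>\<^sup>+t. indicator (fiber b B (?x f)) t \<partial>lborel) \<partial>?P)"
      by (intro nn_integral_cong) (auto simp: indicator_def fiber_def perp)
    finally show ?thesis by simp
  qed
  show ?thesis
    by (simp add: * fiber_steiner[OF b] emeasure_lborel_abs_less)
qed

text \<open>Otherwise \<open>T\<close> would fit into an interval of length
  \<open>2 * \<bar>a\<bar>\<close> starting at its infimum. The two points replace the endpoints of
  the hull of a fiber, which need not be attained or finite.\<close>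

lemma emeasure_lborel_imp_far_points:
  fixes T :: "real set"
  assumes "T \<in> sets borel" "ennreal (2 * \<bar>a\<bar>) < emeasure lborel T"
  obtains s1 s2 where "s1 \<in> T" "s2 \<in> T" "s2 - s1 > 2 * \<bar>a\<bar>"
proof -
  have "\<exists>s1\<in>T. \<exists>s2\<in>T. s2 - s1 > 2 * \<bar>a\<bar>"
  proof (rule ccontr)
    assume "\<not> ?thesis"
    then have no: "\<And>s1 s2. s1 \<in> T \<Longrightarrow> s2 \<in> T \<Longrightarrow> s2 - s1 \<le> 2 * \<bar>a\<bar>" by force
    have "T \<noteq> {}" using assms by auto
    then obtain s0 where s0: "s0 \<in> T" by auto
    have bdd: "bdd_below T"
      by (rule bdd_belowI[of _ "s0 - 2 * \<bar>a\<bar>"]) (use no[OF _ s0] in force)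
    have "T \<subseteq> {Inf T .. Inf T + 2 * \<bar>a\<bar>}"
    proof
      fix s assume s: "s \<in> T"
      have "s - 2 * \<bar>a\<bar> \<le> Inf T"
        using no[OF _ s] \<open>T \<noteq> {}\<close> by (intro cInf_greatest) force+
      then show "s \<in> {Inf T .. Inf T + 2 * \<bar>a\<bar>}"
        using cInf_lower[OF s bdd] by auto
    qed
    then have "emeasure lborel T \<le> emeasure lborel {Inf T .. Inf T + 2 * \<bar>a\<bar>}"
      by (rule emeasure_mono) simp
    then show False using assms by simp
  qed
  then show ?thesis using that by blast
qed

text \<open>The fibers through x and y contain pairs s1, s2 and t1, t2 whose gaps exceed
  \<open>2 * \<bar>x \<bullet> b\<bar>\<close> and \<open>2 * \<bar>y \<bullet> b\<bar>\<close>. As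
  (s2 - t1) + (t2 - s1) is the sum of the gaps, one of the two differences is at least
  \<open>\<bar>x \<bullet> b - y \<bullet> b\<bar>\<close> in absolute value. Moving x and y along b
  to the corresponding points of \<open>A\<close> changes no other coordinate, the height along e
  included, and does not decrease the distance.\<close>

lemma steiner_slice_diameter:
  fixes A :: "'a::euclidean_space set"
  assumes J: "finite J" "J \<subseteq> Basis" and b: "b \<in> J" and e: "e \<in> Basis" "b \<noteq> e"
    and [measurable]: "A \<in> sets borel"
    and A: "\<And>x y. x \<in> A \<Longrightarrow> y \<in> A \<Longrightarrow> x \<bullet> e = y \<bullet> e \<Longrightarrow> (\<Sum>c\<in>J. ((x - y) \<bullet> c)\<^sup>2) \<le> h (x \<bullet> e)"
    and xy: "x \<in> steiner b A" "y \<in> steiner b A" "x \<bullet> e = y \<bullet> e"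
  shows "(\<Sum>c\<in>J. ((x - y) \<bullet> c)\<^sup>2) \<le> h (x \<bullet> e)"
proof -
  have bB: "b \<in> Basis" using J b by auto
  obtain s1 s2 where s: "s1 \<in> fiber b A x" "s2 \<in> fiber b A x" "s2 - s1 > 2 * \<bar>x \<bullet> b\<bar>"
    using xy(1) unfolding steiner_def by (auto elim!: emeasure_lborel_imp_far_points[rotated])
  obtain t1 t2 where t: "t1 \<in> fiber b A y" "t2 \<in> fiber b A y" "t2 - t1 > 2 * \<bar>y \<bullet> b\<bar>"
    using xy(2) unfolding steiner_def by (auto elim!: emeasure_lborel_imp_far_points[rotated])
  have main: "(\<Sum>c\<in>J. ((x - y) \<bullet> c)\<^sup>2) \<le> h (x \<bullet> e)"
    if st: "s \<in> fiber b A x" "t \<in> fiber b A y" "\<bar>x \<bullet> b - y \<bullet> b\<bar> \<le> \<bar>s - t\<bar>" for s t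
  proof -
    let ?x = "x + (s - x \<bullet> b) *\<^sub>R b" and ?y = "y + (t - y \<bullet> b) *\<^sub>R b"
    have e': "?x \<bullet> e = x \<bullet> e" "?y \<bullet> e = y \<bullet> e"
      using e bB by (auto simp: inner_add_left inner_Basis)
    have "(\<Sum>c\<in>J. ((x - y) \<bullet> c)\<^sup>2) \<le> (\<Sum>c\<in>J. ((?x - ?y) \<bullet> c)\<^sup>2)"
    proof (rule sum_mono)
      fix c assume "c \<in> J"
      then have c: "c \<in> Basis" using J by auto
      show "((x - y) \<bullet> c)\<^sup>2 \<le> ((?x - ?y) \<bullet> c)\<^sup>2"
      proof (cases "c = b")
        case True
        have "(?x - ?y) \<bullet> b = s - t"
          using bB by (simp add: algebra_simps)
        then show ?thesis
          using True st(3) by (simp add: inner_diff_left abs_le_square_iff)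
      next
        case False
        then have "(?x - ?y) \<bullet> c = (x - y) \<bullet> c"
          using bB c by (simp add: algebra_simps inner_Basis)
        then show ?thesis by simp
      qed
    qed
    also have "\<dots> \<le> h (?x \<bullet> e)"
      using st xy(3) by (intro A) (auto simp: fiber_def e')
    finally show ?thesis by (simp add: e')
  qed
  show ?thesis
  proof (cases "\<bar>x \<bullet> b - y \<bullet> b\<bar> \<le> \<bar>s2 - t1\<bar>")
    case True
    then show ?thesis using main s t by blast
  next
    case False
    then have "\<bar>x \<bullet> b - y \<bullet> b\<bar> \<le> \<bar>s1 - t2\<bar>" using s t by linarith
    then show ?thesis using main s t by blast
  qed
qed

lemma steiner_reflect_self:
  assumes "b \<in> Basis" "x \<in> steiner b A"
  shows "x - (2 * (x \<bullet> b)) *\<^sub>R b \<in> steiner b A"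
  using assms fiber_shift[of b A x "- (2 * (x \<bullet> b))"]
  by (auto simp: steiner_def inner_diff_left)

text \<open>Reflection in c maps fibers along b to fibers along b with the same parameter, hence the
  same length. Symmetries gained in earlier directions thus survive later symmetrizations.\<close>

lemma steiner_reflect:
  assumes bc: "b \<in> Basis" "c \<in> Basis" "b \<noteq> c"
    and A: "\<And>x. x \<in> A \<Longrightarrow> x - (2 * (x \<bullet> c)) *\<^sub>R c \<in> A" and x: "x \<in> steiner b A"
  shows "x - (2 * (x \<bullet> c)) *\<^sub>R c \<in> steiner b A"
proof -
  let ?r = "\<lambda>x. x - (2 * (x \<bullet> c)) *\<^sub>R c"
  have rr: "?r (?r x) = x" for x using bc by (simp add: algebra_simps)
  have iff: "?r x \<in> A \<longleftrightarrow> x \<in> A" for x using A[of x] A[of "?r x"] rr[of x] by auto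
  have rb: "?r x \<bullet> b = x \<bullet> b" for x using bc by (simp add: algebra_simps inner_Basis)
  have "?r x + (t - ?r x \<bullet> b) *\<^sub>R b = ?r (x + (t - x \<bullet> b) *\<^sub>R b)" for t
    unfolding rb using bc by (simp add: algebra_simps inner_Basis)
  then have "fiber b A (?r x) = fiber b A x"
    unfolding fiber_def by (simp only: iff)
  then show ?thesis using x by (simp add: steiner_def rb)
qed

lemma steiner_imp_fiber_nonempty:
  assumes "b \<in> Basis" "e \<in> Basis" "b \<noteq> e" "x \<in> steiner b A"
  obtains y where "y \<in> A" "y \<bullet> e = x \<bullet> e"
proof -
  have "fiber b A x \<noteq> {}" using assms by (auto simp: steiner_def)
  then obtain t where "x + (t - x \<bullet> b) *\<^sub>R b \<in> A" by (auto simp: fiber_def)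
  then show ?thesis
    using assms by (intro that[of "x + (t - x \<bullet> b) *\<^sub>R b"]) (auto simp: inner_add_left inner_Basis)
qed

text \<open>One symmetrization per direction of \<open>F\<close>. Since \<open>steiner\<close> drops
  empty fibers and acts orthogonally to e, no new height appears, and a slice bound depending on the
  height alone is inherited.\<close>

lemma exists_symmetrization:
  fixes A :: "'a::euclidean_space set" and h :: "real \<Rightarrow> real"
  assumes e: "e \<in> Basis" and A: "A \<in> sets borel" "\<And>x. x \<in> A \<Longrightarrow> x \<bullet> e \<in> I"
    and diam: "\<And>x y. x \<in> A \<Longrightarrow> y \<in> A \<Longrightarrow> x \<bullet> e = y \<bullet> e \<Longrightarrow>
      (\<Sum>c\<in>Basis - {e}. ((x - y) \<bullet> c)\<^sup>2) \<le> h (x \<bullet> e)"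
    and F: "F \<subseteq> Basis - {e}"
  obtains B where "B \<in> sets borel" "emeasure lborel B = emeasure lborel A" "\<And>x. x \<in> B \<Longrightarrow> x \<bullet> e \<in> I"
    "\<And>x y. x \<in> B \<Longrightarrow> y \<in> B \<Longrightarrow> x \<bullet> e = y \<bullet> e \<Longrightarrow>
      (\<Sum>c\<in>Basis - {e}. ((x - y) \<bullet> c)\<^sup>2) \<le> h (x \<bullet> e)"
    "\<And>x b. x \<in> B \<Longrightarrow> b \<in> F \<Longrightarrow> x - (2 * (x \<bullet> b)) *\<^sub>R b \<in> B"
proof -
  have "finite F" using F finite_subset by fastforce
  then have "\<exists>B. B \<in> sets borel \<and> emeasure lborel B = emeasure lborel A \<and> (\<forall>x\<in>B. x \<bullet> e \<in> I) \<and>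
    (\<forall>x\<in>B. \<forall>y\<in>B. x \<bullet> e = y \<bullet> e \<longrightarrow> (\<Sum>c\<in>Basis - {e}. ((x - y) \<bullet> c)\<^sup>2) \<le> h (x \<bullet> e)) \<and>
    (\<forall>x\<in>B. \<forall>b\<in>F. x - (2 * (x \<bullet> b)) *\<^sub>R b \<in> B)"
    using F
  proof (induction F rule: finite_induct)
    case empty
    then show ?case using A diam by (intro exI[of _ A]) auto
  next
    case (insert b F)
    then obtain B where B: "B \<in> sets borel" "emeasure lborel B = emeasure lborel A" "\<forall>x\<in>B. x \<bullet> e \<in> I"
      "\<And>x y. x \<in> B \<Longrightarrow> y \<in> B \<Longrightarrow> x \<bullet> e = y \<bullet> e \<Longrightarrow>
        (\<Sum>c\<in>Basis - {e}. ((x - y) \<bullet> c)\<^sup>2) \<le> h (x \<bullet> e)"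
      "\<And>x b. x \<in> B \<Longrightarrow> b \<in> F \<Longrightarrow> x - (2 * (x \<bullet> b)) *\<^sub>R b \<in> B"
      by auto
    have b: "b \<in> Basis" "b \<in> Basis - {e}" "b \<noteq> e" using insert by auto
    show ?case
    proof (intro exI[of _ "steiner b B"] conjI ballI impI)
      show "steiner b B \<in> sets borel" using B(1) by measurable
      show "emeasure lborel (steiner b B) = emeasure lborel A"
        using B b by (simp add: emeasure_steiner)
      show "x \<bullet> e \<in> I" if "x \<in> steiner b B" for x
        using steiner_imp_fiber_nonempty[OF b(1) e b(3) that] B(3) by metis
      show "(\<Sum>c\<in>Basis - {e}. ((x - y) \<bullet> c)\<^sup>2) \<le> h (x \<bullet> e)"
        if "x \<in> steiner b B" "y \<in> steiner b B" "x \<bullet> e = y \<bullet> e" for x y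
        by (rule steiner_slice_diameter[OF _ _ b(2) e b(3) B(1) B(4) that]) auto
      show "x - (2 * (x \<bullet> c)) *\<^sub>R c \<in> steiner b B" if "x \<in> steiner b B" "c \<in> insert b F" for x c
      proof (cases "c = b")
        case True
        then show ?thesis using steiner_reflect_self b(1) that(1) by blast
      next
        case False
        then have "c \<in> F" "c \<in> Basis" using that insert by auto
        then show ?thesis using b(1) False B(5) that(1) by (intro steiner_reflect) auto
      qed
    qed
  qed
  then show ?thesis using that by blast
qed

section \<open>Round cones and the isodiametric inequality\<close>

definition round_cone :: "'a::euclidean_space \<Rightarrow> real \<Rightarrow> real \<Rightarrow> 'a set" where
  "round_cone e \<tau> c =
     {y. 0 \<le> y \<bullet> e \<and> y \<bullet> e \<le> c \<and> (\<Sum>b\<in>Basis - {e}. (y \<bullet> b)\<^sup>2) \<le> (\<tau> * (y \<bullet> e))\<^sup>2}"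

lemma round_cone_borel [measurable]: "round_cone e \<tau> c \<in> sets borel"
  unfolding round_cone_def by measurable

text \<open>The slice at height t is a ball of radius \<open>\<tau> * t\<close> in the remaining
  coordinates; integrating its volume over t produces the divisor \<open>DIM('a)\<close>.\<close>

lemma emeasure_round_cone:
  fixes e :: "'a::euclidean_space"
  assumes e: "e \<in> Basis" and "\<tau> > 0" "c \<ge> 0"
  shows "emeasure lborel (round_cone e \<tau> c)
    = ennreal (unit_ball_vol (real (DIM('a) - 1)) * \<tau> ^ (DIM('a) - 1) * c ^ DIM('a) / DIM('a))"
proof -
  define k where "k = DIM('a) - 1"
  have d: "DIM('a) = Suc k" by (simp add: k_def)
  have ck: "card (Basis - {e}) = k" using e by (simp add: k_def)
  let ?P = "\<Pi>\<^sub>M b\<in>Basis - {e}. (lborel :: real measure)"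
  let ?emb = "\<lambda>f t. (\<Sum>b\<in>Basis - {e}. f b *\<^sub>R b) + t *\<^sub>R e"
  have emb_e: "?emb f t \<bullet> e = t" for f t
    using e by (auto simp: inner_add_left inner_sum_left inner_Basis intro!: sum.neutral)
  have emb_b: "?emb f t \<bullet> b = f b" if "b \<in> Basis - {e}" for f t b
  proof -
    have "?emb f t \<bullet> b = (\<Sum>c\<in>Basis - {e}. f c * (c \<bullet> b))"
      using e that by (auto simp: inner_add_left inner_sum_left inner_not_same_Basis)
    also have "\<dots> = (\<Sum>c\<in>Basis - {e}. if c = b then f c else 0)"
      using that by (intro sum.cong) (auto simp: inner_not_same_Basis)
    also have "\<dots> = f b" using that by (subst sum.delta) auto
    finally show ?thesis .
  qed
  have "emeasure lborel (round_cone e \<tau> c) = (\<integral>\<^sup>+x. indicator (round_cone e \<tau> c) x \<partial>lborel)" by simp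
  also have "\<dots> = (\<integral>\<^sup>+t. (\<integral>\<^sup>+f. indicator (round_cone e \<tau> c) (?emb f t) \<partial>?P) \<partial>lborel)"
    by (rule nn_integral_lborel_slice(2)[OF e]) simp
  also have "\<dots> = (\<integral>\<^sup>+t. ennreal (unit_ball_vol (real k) * (\<tau> * t) ^ k) * indicator {0..c} t \<partial>lborel)"
  proof (rule nn_integral_cong_AE)
    \<comment> \<open>The apex is discarded so that the radius of every remaining slice is
      positive.\<close>
    have "AE t in lborel. t \<noteq> (0::real)" by (rule AE_lborel_singleton)
    then show "AE t in lborel. (\<integral>\<^sup>+f. indicator (round_cone e \<tau> c) (?emb f t) \<partial>?P)
        = ennreal (unit_ball_vol (real k) * (\<tau> * t) ^ k) * indicator {0..c} t"
    proof eventually_elim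
      case (elim t)
      show ?case
      proof (cases "t \<in> {0..c}")
        case True
        then have t: "\<tau> * t > 0" using elim \<open>\<tau> > 0\<close> by auto
        have "(\<integral>\<^sup>+f. indicator (round_cone e \<tau> c) (?emb f t) \<partial>?P)
          = (\<integral>\<^sup>+f. indicator ({f. sqrt (\<Sum>b\<in>Basis - {e}. (f b)\<^sup>2) \<le> \<tau> * t} \<inter> space ?P) f \<partial>?P)"
        proof (rule nn_integral_cong)
          fix f assume f: "f \<in> space ?P"
          have "(\<Sum>b\<in>Basis - {e}. (?emb f t \<bullet> b)\<^sup>2) = (\<Sum>b\<in>Basis - {e}. (f b)\<^sup>2)"
            by (rule sum.cong[OF refl], subst emb_b) auto
          moreover have "sqrt (\<Sum>b\<in>Basis - {e}. (f b)\<^sup>2) \<le> \<tau> * t \<longleftrightarrow> (\<Sum>b\<in>Basis - {e}. (f b)\<^sup>2) \<le> (\<tau> * t)\<^sup>2"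
            using t by (intro real_sqrt_le_iff') (auto intro!: sum_nonneg)
          ultimately have "?emb f t \<in> round_cone e \<tau> c \<longleftrightarrow> sqrt (\<Sum>b\<in>Basis - {e}. (f b)\<^sup>2) \<le> \<tau> * t"
            unfolding round_cone_def mem_Collect_eq emb_e using True by simp
          then show "indicator (round_cone e \<tau> c) (?emb f t)
              = (indicator ({f. sqrt (\<Sum>b\<in>Basis - {e}. (f b)\<^sup>2) \<le> \<tau> * t} \<inter> space ?P) f :: ennreal)"
            using f by (simp add: indicator_def)
        qed
        also have "\<dots> = emeasure ?P ({f. sqrt (\<Sum>b\<in>Basis - {e}. (f b)\<^sup>2) \<le> \<tau> * t} \<inter> space ?P)"
          by (rule nn_integral_indicator) measurable
        also have "\<dots> = ennreal (unit_ball_vol (real k) * (\<tau> * t) ^ k)"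
          by (subst emeasure_cball_aux) (use t ck in auto)
        finally show ?thesis using True by simp
      next
        case False
        then have "?emb f t \<notin> round_cone e \<tau> c" for f
          unfolding round_cone_def mem_Collect_eq emb_e by auto
        then show ?thesis using False by simp
      qed
    qed
  qed
  also have "\<dots> = ennreal (unit_ball_vol (real k) * \<tau> ^ k * c ^ Suc k / Suc k
      - unit_ball_vol (real k) * \<tau> ^ k * 0 ^ Suc k / Suc k)"
  proof (rule nn_integral_FTC_Icc)
    show "((\<lambda>t. unit_ball_vol (real k) * \<tau> ^ k * t ^ Suc k / Suc k) has_field_derivative
      unit_ball_vol (real k) * (\<tau> * t) ^ k) (at t)" for t
      by (auto intro!: derivative_eq_intros simp: power_mult_distrib simp del: power_Suc of_nat_Suc)
  qed (use assms in auto)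
  finally show ?thesis by (simp add: d)
qed

text \<open>Isodiametric inequality for sets whose slices orthogonal to \<open>e\<close> have diameter at most
  \<open>\<rho>\<close> times their height: symmetrizing in all directions other than \<open>e\<close> centres every slice,
  so that the set lands in a round cone.\<close>

lemma isodiametric_cone:
  fixes A :: "'a::euclidean_space set"
  assumes e: "e \<in> Basis" and A: "A \<in> sets borel" "\<And>x. x \<in> A \<Longrightarrow> x \<bullet> e \<in> {0..1}" and \<rho>: "0 < \<rho>"
    and diam: "\<And>x y. x \<in> A \<Longrightarrow> y \<in> A \<Longrightarrow> x \<bullet> e = y \<bullet> e \<Longrightarrow> norm (x - y) \<le> \<rho> * (x \<bullet> e)"
  shows "emeasure lborel A
    \<le> ennreal (unit_ball_vol (real (DIM('a) - 1)) * (\<rho> / 2) ^ (DIM('a) - 1) / DIM('a))"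
proof -
  have "(\<Sum>c\<in>Basis - {e}. ((x - y) \<bullet> c)\<^sup>2) \<le> (\<rho> * (x \<bullet> e))\<^sup>2"
    if xy: "x \<in> A" "y \<in> A" "x \<bullet> e = y \<bullet> e" for x y
  proof -
    have "(\<Sum>c\<in>Basis - {e}. ((x - y) \<bullet> c)\<^sup>2) \<le> (\<Sum>c\<in>Basis. ((x - y) \<bullet> c)\<^sup>2)"
      by (intro sum_mono2) auto
    also have "\<dots> = (norm (x - y))\<^sup>2"
      by (subst norm_eq_sqrt_inner, subst euclidean_inner) (simp add: power2_eq_square sum_nonneg)
    also have "\<dots> \<le> (\<rho> * (x \<bullet> e))\<^sup>2"
      using diam[OF xy] by (intro power_mono) auto
    finally show ?thesis .
  qed
  from exists_symmetrization[OF e A this order_refl] obtain B where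
    B: "B \<in> sets borel" "emeasure lborel B = emeasure lborel A" "\<And>x. x \<in> B \<Longrightarrow> x \<bullet> e \<in> {0..1}"
    "\<And>x y. x \<in> B \<Longrightarrow> y \<in> B \<Longrightarrow> x \<bullet> e = y \<bullet> e \<Longrightarrow>
      (\<Sum>c\<in>Basis - {e}. ((x - y) \<bullet> c)\<^sup>2) \<le> (\<rho> * (x \<bullet> e))\<^sup>2"
    "\<And>x b. x \<in> B \<Longrightarrow> b \<in> Basis - {e} \<Longrightarrow> x - (2 * (x \<bullet> b)) *\<^sub>R b \<in> B"
    by blast
  have "B \<subseteq> round_cone e (\<rho> / 2) 1"
  proof
    fix x assume x: "x \<in> B"
    have refl: "x - (\<Sum>b\<in>G. (2 * (x \<bullet> b)) *\<^sub>R b) \<in> B" if "finite G" "G \<subseteq> Basis - {e}" for G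
      using that
    proof (induction G rule: finite_induct)
      case empty
      then show ?case using x by simp
    next
      case (insert b G)
      let ?y = "x - (\<Sum>b\<in>G. (2 * (x \<bullet> b)) *\<^sub>R b)"
      have "c \<bullet> b = 0" if "c \<in> G" for c
        using insert that by (intro inner_not_same_Basis) auto
      then have "(\<Sum>c\<in>G. (2 * (x \<bullet> c)) *\<^sub>R c) \<bullet> b = 0"
        by (simp add: inner_sum_left)
      then have "?y \<bullet> b = x \<bullet> b" by (simp add: inner_diff_left)
      then show ?case
        using B(5)[of ?y b] insert by (simp add: algebra_simps)
    qed
    \<comment> \<open>The composition of all reflections orthogonal to e carries x to its mirror
      image across the axis. Both points lie in the same slice and differ by twice the part of x
      orthogonal to e, so a diameter bound becomes a radius bound with half the constant.\<close>
    let ?z = "x - (\<Sum>b\<in>Basis - {e}. (2 * (x \<bullet> b)) *\<^sub>R b)"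
    have z: "?z \<in> B" by (rule refl) auto
    have "(\<Sum>b\<in>Basis - {e}. (2 * (x \<bullet> b)) *\<^sub>R b) \<bullet> e = 0"
      using e by (auto simp: inner_sum_left inner_Basis intro!: sum.neutral)
    then have "x \<bullet> e = ?z \<bullet> e" by (simp add: inner_diff_left)
    from B(4)[OF x z this] have "(\<Sum>c\<in>Basis - {e}. ((x - ?z) \<bullet> c)\<^sup>2) \<le> (\<rho> * (x \<bullet> e))\<^sup>2" .
    also have "(\<Sum>c\<in>Basis - {e}. ((x - ?z) \<bullet> c)\<^sup>2) = (\<Sum>c\<in>Basis - {e}. 4 * (x \<bullet> c)\<^sup>2)"
    proof (rule sum.cong, rule HOL.refl)
      fix c assume c: "c \<in> Basis - {e}"
      have "(\<Sum>b\<in>Basis - {e}. (2 * (x \<bullet> b)) *\<^sub>R b) \<bullet> c = (\<Sum>b\<in>Basis - {e}. 2 * (x \<bullet> b) * (b \<bullet> c))"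
        by (simp add: inner_sum_left)
      also have "\<dots> = (\<Sum>b\<in>Basis - {e}. if b = c then 2 * (x \<bullet> b) else 0)"
        using c by (intro sum.cong) (auto simp: inner_not_same_Basis)
      also have "\<dots> = 2 * (x \<bullet> c)" using c by (subst sum.delta) auto
      finally show "((x - ?z) \<bullet> c)\<^sup>2 = 4 * (x \<bullet> c)\<^sup>2" by (simp add: power2_eq_square)
    qed
    finally have "4 * (\<Sum>c\<in>Basis - {e}. (x \<bullet> c)\<^sup>2) \<le> (\<rho> * (x \<bullet> e))\<^sup>2"
      by (simp only: sum_distrib_left)
    then have "(\<Sum>c\<in>Basis - {e}. (x \<bullet> c)\<^sup>2) \<le> (\<rho> / 2 * (x \<bullet> e))\<^sup>2"
      by (simp add: power_mult_distrib power_divide)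
    then show "x \<in> round_cone e (\<rho> / 2) 1"
      using B(3)[OF x] by (simp add: round_cone_def)
  qed
  then have "emeasure lborel B \<le> emeasure lborel (round_cone e (\<rho> / 2) 1)"
    by (rule emeasure_mono) simp
  then show ?thesis
    using B(2) e \<rho> by (simp add: emeasure_round_cone)
qed

section \<open>Hausdorff measure of the unit sphere\<close>

definition solid_cone :: "'a::euclidean_space set \<Rightarrow> 'a set" where
  "solid_cone V = {y. y \<noteq> 0 \<and> norm y \<le> 1 \<and> y /\<^sub>R norm y \<in> V}"

definition cone_area :: "'a::euclidean_space set \<Rightarrow> real" where
  "cone_area V = DIM('a) * measure lborel (solid_cone V)"

lemma solid_cone_borel [measurable]:
  assumes [measurable]: "V \<in> sets borel"
  shows "solid_cone V \<in> sets borel"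
  unfolding solid_cone_def by measurable

lemma solid_cone_mono: "V \<subseteq> W \<Longrightarrow> solid_cone V \<subseteq> solid_cone W"
  by (auto simp: solid_cone_def)

lemma solid_cone_UN: "solid_cone (\<Union>i\<in>I. V i) = (\<Union>i\<in>I. solid_cone (V i))"
  by (auto simp: solid_cone_def)

lemma solid_cone_Un: "solid_cone (V \<union> W) = solid_cone V \<union> solid_cone W"
  by (auto simp: solid_cone_def)

lemma solid_cone_disjoint: "V \<inter> W = {} \<Longrightarrow> solid_cone V \<inter> solid_cone W = {}"
  by (auto simp: solid_cone_def)

lemma solid_cone_fmeasurable:
  fixes V :: "'a::euclidean_space set"
  assumes "V \<in> sets borel"
  shows "solid_cone V \<in> fmeasurable lborel"
proof (rule fmeasurableI2)
  show "solid_cone V \<subseteq> cball 0 1" by (auto simp: solid_cone_def)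
  show "cball 0 1 \<in> fmeasurable (lborel :: 'a measure)"
    by (rule fmeasurableI) (auto simp: emeasure_cball)
qed (use assms in auto)

lemma cone_area_nonneg [simp]: "0 \<le> cone_area V"
  by (simp add: cone_area_def)

lemma ennreal_cone_area:
  fixes V :: "'a::euclidean_space set"
  assumes "V \<in> sets borel"
  shows "ennreal (cone_area V) = ennreal DIM('a) * emeasure lborel (solid_cone V)"
  using solid_cone_fmeasurable[OF assms]
  by (simp add: cone_area_def ennreal_mult emeasure_eq_measure2)

lemma cone_area_mono:
  assumes "V \<subseteq> W" "V \<in> sets borel" "W \<in> sets borel"
  shows "cone_area V \<le> cone_area W"
  unfolding cone_area_def using assms
  by (intro mult_left_mono measure_mono_fmeasurable solid_cone_mono solid_cone_fmeasurable) auto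

lemma cone_area_Un_disjoint:
  assumes "V \<inter> W = {}" "V \<in> sets borel" "W \<in> sets borel"
  shows "cone_area (V \<union> W) = cone_area V + cone_area W"
  unfolding cone_area_def solid_cone_Un using assms
  by (subst measure_Un3) (auto intro!: solid_cone_fmeasurable simp: solid_cone_disjoint distrib_left)

lemma cone_area_UN_disjoint:
  assumes "finite F" "\<And>i. i \<in> F \<Longrightarrow> V i \<in> sets borel" "disjoint_family_on V F"
  shows "cone_area (\<Union>i\<in>F. V i) = (\<Sum>i\<in>F. cone_area (V i))"
  using assms
proof (induction F rule: finite_induct)
  case empty
  then show ?case by (simp add: cone_area_def solid_cone_def)
next
  case (insert a F)
  have "V a \<inter> (\<Union>i\<in>F. V i) = {}"
    using insert.prems(2) insert.hyps(2) unfolding disjoint_family_on_def by fastforce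
  moreover have "(\<Union>i\<in>F. V i) \<in> sets borel" using insert by (intro sets.finite_UN) auto
  ultimately have "cone_area (V a \<union> (\<Union>i\<in>F. V i)) = cone_area (V a) + cone_area (\<Union>i\<in>F. V i)"
    using insert.prems by (intro cone_area_Un_disjoint) auto
  then show ?case
    using insert by (simp add: disjoint_family_on_insert)
qed

lemma cone_area_subadditive:
  fixes W :: "nat \<Rightarrow> 'a::euclidean_space set"
  assumes "V \<subseteq> (\<Union>i. W i)" "V \<in> sets borel" "\<And>i. W i \<in> sets borel"
  shows "ennreal (cone_area V) \<le> (\<Sum>i. ennreal (cone_area (W i)))"
proof -
  have "emeasure lborel (solid_cone V) \<le> emeasure lborel (\<Union>i. solid_cone (W i))"
    using assms by (intro emeasure_mono) (auto simp: solid_cone_UN[symmetric] dest!: solid_cone_mono)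
  also have "\<dots> \<le> (\<Sum>i. emeasure lborel (solid_cone (W i)))"
    using assms by (intro emeasure_subadditive_countably) auto
  finally have "ennreal DIM('a) * emeasure lborel (solid_cone V)
      \<le> ennreal DIM('a) * (\<Sum>i. emeasure lborel (solid_cone (W i)))"
    by (rule mult_left_mono) simp
  then show ?thesis using assms by (simp add: ennreal_cone_area)
qed

lemma cone_area_sphere:
  "cone_area (sphere (0 :: 'a::euclidean_space) 1) = DIM('a) * unit_ball_vol DIM('a)"
proof -
  have eq: "solid_cone (sphere (0::'a) 1) = cball 0 1 - {0}"
    by (auto simp: solid_cone_def)
  have "emeasure lborel (cball (0::'a) 1 - {0}) = emeasure lborel (cball (0::'a) 1)"
    by (intro emeasure_Diff_null_set) auto
  then have "measure lborel (solid_cone (sphere (0::'a) 1)) = unit_ball_vol DIM('a)"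
    unfolding eq by (simp add: measure_def emeasure_cball)
  then show ?thesis by (simp add: cone_area_def)
qed

section \<open>Gnomonic projection and the lower bound for the Hausdorff measure\<close>

lemma power2_norm_diff_of_unit:
  fixes x y :: "'a::real_inner"
  assumes "norm x = 1" "norm y = 1"
  shows "(norm (x - y))\<^sup>2 = 2 - 2 * (x \<bullet> y)"
  using assms by (simp add: power2_norm_eq_inner inner_diff norm_eq_1 inner_commute)

lemma inner_ge_of_unit:
  fixes x y :: "'a::real_inner"
  assumes "norm x = 1" "norm y = 1" "norm (x - y) \<le> r"
  shows "x \<bullet> y \<ge> 1 - r\<^sup>2 / 2"
proof -
  have "(norm (x - y))\<^sup>2 \<le> r\<^sup>2" using assms(3) by (intro power_mono) auto
  then show ?thesis using power2_norm_diff_of_unit[OF assms(1,2)] by simp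
qed

text \<open>The factor by which projecting from the origin to the tangent plane at a point may
  enlarge a bound \<rho> on distances, among unit vectors within \<rho> of that point. It tends to 1
  as \<rho> tends to 0.\<close>

definition distortion :: "real \<Rightarrow> real" where
  "distortion \<rho> = (1 + \<rho>) / (1 - \<rho>)\<^sup>2"

lemma distortion_ge_1: "0 \<le> \<rho> \<Longrightarrow> \<rho> < 1 \<Longrightarrow> 1 \<le> distortion \<rho>"
proof -
  assume \<rho>: "0 \<le> \<rho>" "\<rho> < 1"
  have "(1 - \<rho>)\<^sup>2 \<le> 1" using \<rho> by (intro power_le_one) auto
  then show ?thesis using \<rho> by (simp add: distortion_def divide_simps)
qed

lemma distortion_mono: "0 \<le> \<rho> \<Longrightarrow> \<rho> \<le> \<delta> \<Longrightarrow> \<delta> < 1 \<Longrightarrow> distortion \<rho> \<le> distortion \<delta>"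
  unfolding distortion_def by (intro frac_le power_mono) auto

text \<open>With a and b the heights of x and y, the difference of the projections is (x - y) / a +
  (1 / a - 1 / b) y. The heights are at least 1 - \<rho>, and they differ only to second order in
  \<rho>; this gives \<rho> + \<rho> * \<rho> over the square of 1 - \<rho>.\<close>

lemma norm_gnomonic_diff_le:
  fixes x y e :: "'a::real_inner"
  assumes u: "norm x = 1" "norm y = 1" "norm e = 1" and \<rho>: "0 < \<rho>" "\<rho> < 1"
    and close: "norm (x - e) \<le> \<rho>" "norm (y - e) \<le> \<rho>" "norm (x - y) \<le> \<rho>"
  shows "norm (x /\<^sub>R (x \<bullet> e) - y /\<^sub>R (y \<bullet> e)) \<le> distortion \<rho> * \<rho>"
proof -
  define a b c where "a = x \<bullet> e" and "b = y \<bullet> e" and "c = 1 - \<rho>"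
  have "\<rho>\<^sup>2 \<le> \<rho>" using \<rho> by (simp add: power2_eq_square mult_left_le_one_le)
  then have c: "0 < c" "c \<le> 1" "c \<le> a" "c \<le> b"
    using inner_ge_of_unit[of x e \<rho>] inner_ge_of_unit[of y e \<rho>] u close \<rho> by (auto simp: a_def b_def c_def)
  have "\<bar>b - a\<bar> \<le> \<rho>\<^sup>2"
  proof -
    \<comment> \<open>Orthogonality allows e to be replaced by e - (x + y) / 2 in the product with x
      - y. That vector has norm at most \<rho>, which supplies the second factor \<rho>.\<close>
    have "(x - y) \<bullet> (x + y) = 0"
      using u by (simp add: inner_diff inner_add inner_commute norm_eq_1)
    then have "a - b = (x - y) \<bullet> ((1/2) *\<^sub>R ((e - x) + (e - y)))"
      by (simp add: a_def b_def algebra_simps)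
    then have "\<bar>a - b\<bar> \<le> norm (x - y) * norm ((1/2) *\<^sub>R ((e - x) + (e - y)))"
      using Cauchy_Schwarz_ineq2 by metis
    also have "\<dots> \<le> \<rho> * \<rho>"
    proof (intro mult_mono)
      have "norm ((e - x) + (e - y)) \<le> norm (e - x) + norm (e - y)" by (rule norm_triangle_ineq)
      then show "norm ((1/2) *\<^sub>R ((e - x) + (e - y))) \<le> \<rho>"
        using close by (simp add: norm_minus_commute)
    qed (use close \<rho> in auto)
    finally show ?thesis by (simp add: power2_eq_square abs_minus_commute)
  qed
  have "x /\<^sub>R a - y /\<^sub>R b = (x - y) /\<^sub>R a + (inverse a - inverse b) *\<^sub>R y"
    by (simp add: algebra_simps)
  then have "norm (x /\<^sub>R a - y /\<^sub>R b) \<le> norm ((x - y) /\<^sub>R a) + norm ((inverse a - inverse b) *\<^sub>R y)"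
    using norm_triangle_ineq by metis
  also have "\<dots> = norm (x - y) * inverse a + \<bar>b - a\<bar> * (inverse a * inverse b)"
  proof -
    have "inverse a - inverse b = (b - a) * (inverse a * inverse b)"
      using c by (simp add: field_simps)
    then show ?thesis using u c by (simp add: abs_mult)
  qed
  also have "\<dots> \<le> \<rho> * (inverse c * inverse c) + \<rho>\<^sup>2 * (inverse c * inverse c)"
  proof (intro add_mono mult_mono \<open>\<bar>b - a\<bar> \<le> \<rho>\<^sup>2\<close> close)
    have "inverse a \<le> inverse c" using c by (intro le_imp_inverse_le) auto
    also have "\<dots> \<le> inverse c * inverse c"
      using c by (simp add: one_le_inverse_iff)
    finally show "inverse a \<le> inverse c * inverse c" .
  qed (use c \<rho> in auto)
  also have "\<dots> = distortion \<rho> * \<rho>"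
    unfolding distortion_def c_def[symmetric] divide_inverse power2_eq_square inverse_mult_distrib
    by (simp add: algebra_simps)
  finally show ?thesis by (simp add: a_def b_def)
qed

text \<open>A point of the cone is its height times the gnomonic projection of its direction.
  Distances inside a slice are therefore the height times distances between projections.\<close>

lemma solid_cone_inner_bounds:
  fixes V :: "'a::euclidean_space set"
  assumes V: "V \<subseteq> sphere 0 1" "e \<in> V" and \<rho>: "0 < \<rho>" "\<rho> < 1"
    and diam: "\<And>x y. x \<in> V \<Longrightarrow> y \<in> V \<Longrightarrow> norm (x - y) \<le> \<rho>"
    and p: "p \<in> solid_cone V"
  shows "p \<bullet> e \<in> {0..1}" and "p = (p \<bullet> e) *\<^sub>R ((p /\<^sub>R norm p) /\<^sub>R ((p /\<^sub>R norm p) \<bullet> e))"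
proof -
  define x where "x = p /\<^sub>R norm p"
  have x: "x \<in> V" "norm p \<le> 1" "p \<noteq> 0" using p by (auto simp: solid_cone_def x_def)
  have nx: "norm x = 1" "norm e = 1" using x V by (auto simp: subset_iff)
  have px: "p = norm p *\<^sub>R x" using x by (simp add: x_def)
  have "\<rho>\<^sup>2 \<le> 1" using \<rho> by (intro power_le_one) auto
  then have pos: "x \<bullet> e > 0"
    using inner_ge_of_unit[of x e \<rho>] diam[of x e] x V nx by auto
  have pe: "p \<bullet> e = norm p * (x \<bullet> e)" by (subst px) simp
  have "x \<bullet> e \<le> 1" using norm_cauchy_schwarz[of x e] nx by simp
  then show "p \<bullet> e \<in> {0..1}"
    using pos x unfolding pe by (auto intro!: mult_le_one)
  show "p = (p \<bullet> e) *\<^sub>R ((p /\<^sub>R norm p) /\<^sub>R ((p /\<^sub>R norm p) \<bullet> e))"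
  proof -
    have "norm p * (x \<bullet> e) * inverse (x \<bullet> e) = norm p" using pos by simp
    then have "(p \<bullet> e) *\<^sub>R (x /\<^sub>R (x \<bullet> e)) = norm p *\<^sub>R x" by (simp add: pe)
    then show ?thesis unfolding x_def[symmetric] by (rule trans[OF px sym])
  qed
qed

text \<open>By the gnomonic estimate the slice at height t has diameter at most
  \<open>distortion \<rho> * \<rho>\<close> times t, which is the hypothesis of
  \<open>isodiametric_cone\<close>; the factor \<open>DIM('a)\<close> in \<open>cone_area\<close>
  cancels the divisor there.\<close>

lemma cone_area_le_axis:
  fixes V :: "'a::euclidean_space set"
  assumes V: "V \<subseteq> sphere 0 1" "e \<in> V" "V \<in> sets borel" and e: "e \<in> Basis" and \<rho>: "0 < \<rho>" "\<rho> < 1"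
    and diam: "\<And>x y. x \<in> V \<Longrightarrow> y \<in> V \<Longrightarrow> norm (x - y) \<le> \<rho>"
  shows "cone_area V
    \<le> unit_ball_vol (real (DIM('a) - 1)) * (distortion \<rho> * \<rho> / 2) ^ (DIM('a) - 1)"
proof -
  note b = solid_cone_inner_bounds[OF V(1,2) \<rho> diam]
  let ?R = "unit_ball_vol (real (DIM('a) - 1)) * (distortion \<rho> * \<rho> / 2) ^ (DIM('a) - 1)"
  have D: "0 < distortion \<rho>" using distortion_ge_1[of \<rho>] \<rho> by auto
  have "emeasure lborel (solid_cone V) \<le> ennreal (?R / DIM('a))"
  proof (rule isodiametric_cone[OF e])
    show "solid_cone V \<in> sets borel" using V by simp
    show "x \<bullet> e \<in> {0..1}" if "x \<in> solid_cone V" for x using b(1)[OF _ _ that] by blast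
    show "0 < distortion \<rho> * \<rho>" using D \<rho> by simp
    fix p q assume pq: "p \<in> solid_cone V" "q \<in> solid_cone V" "p \<bullet> e = q \<bullet> e"
    define x y where "x = p /\<^sub>R norm p" and "y = q /\<^sub>R norm q"
    have xy: "x \<in> V" "y \<in> V" using pq by (auto simp: solid_cone_def x_def y_def)
    have nxy: "norm x = 1" "norm y = 1" "norm e = 1" using xy V by (auto simp: subset_iff)
    have p: "p = (p \<bullet> e) *\<^sub>R (x /\<^sub>R (x \<bullet> e))" using b(2)[OF _ _ pq(1)] by (simp only: x_def)
    have q: "q = (p \<bullet> e) *\<^sub>R (y /\<^sub>R (y \<bullet> e))" using b(2)[OF _ _ pq(2)] by (simp only: y_def pq(3))
    have "p - q = (p \<bullet> e) *\<^sub>R (x /\<^sub>R (x \<bullet> e) - y /\<^sub>R (y \<bullet> e))"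
      using p q by (metis scaleR_diff_right)
    then have "norm (p - q) = (p \<bullet> e) * norm (x /\<^sub>R (x \<bullet> e) - y /\<^sub>R (y \<bullet> e))"
      using b(1)[OF _ _ pq(1)] by simp
    also have "\<dots> \<le> (p \<bullet> e) * (distortion \<rho> * \<rho>)"
      using b(1)[OF _ _ pq(1)] xy V nxy \<rho> by (intro mult_left_mono norm_gnomonic_diff_le diam) auto
    finally show "norm (p - q) \<le> distortion \<rho> * \<rho> * (p \<bullet> e)" by (simp add: mult_ac)
  qed
  then have "ennreal (cone_area V) \<le> ennreal DIM('a) * ennreal (?R / DIM('a))"
    unfolding ennreal_cone_area[OF V(3)] by (rule mult_left_mono) simp
  also have "\<dots> = ennreal ?R"
    using D \<rho> by (subst ennreal_mult[symmetric]) auto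
  finally show ?thesis using D \<rho> by (subst (asm) ennreal_le_iff) auto
qed

lemma solid_cone_vimage_linear_isometry:
  fixes f :: "'a::euclidean_space \<Rightarrow> 'a"
  assumes "linear f" "\<And>x. norm (f x) = norm x"
  shows "solid_cone (f -` V) = f -` solid_cone V"
proof -
  have "f y = 0 \<longleftrightarrow> y = 0" for y by (metis assms(2) norm_eq_zero)
  then show ?thesis
    unfolding solid_cone_def vimage_def mem_Collect_eq assms(2) linear_scale[OF assms(1)] by simp
qed

lemma cone_area_vimage_linear_isometry:
  fixes f :: "'a::euclidean_space \<Rightarrow> 'a"
  assumes "linear f" "\<And>x. norm (f x) = norm x" "V \<in> sets borel"
  shows "cone_area (f -` V) = cone_area V"
  using emeasure_lborel_vimage_linear_isometry[OF assms(1,2) solid_cone_borel[OF assms(3)]]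
  by (simp add: cone_area_def solid_cone_vimage_linear_isometry assms measure_def)

text \<open>Symmetrization works along coordinate directions, so the axis of a cone has to be a
  basis vector. Rotational invariance of \<open>cone_area\<close> then extends the estimates to
  cones around any unit vector.\<close>

lemma exists_rotation_from_basis:
  fixes u :: "real^'n"
  assumes "norm u = 1"
  obtains e :: "real^'n" and f :: "real^'n \<Rightarrow> real^'n" where "e \<in> Basis" "linear f" "\<And>x. norm (f x) = norm x" "f e = u"
proof -
  have "norm (axis undefined 1 :: real^'n) = norm u" using assms by simp
  then obtain f :: "real^'n \<Rightarrow> real^'n" where f: "orthogonal_transformation f" "f (axis undefined 1) = u"
    using orthogonal_transformation_exists by blast
  show ?thesis
    by (rule that[of "axis undefined 1" f])
       (use f in \<open>auto simp: orthogonal_transformation axis_in_Basis_iff\<close>)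
qed

lemma borel_vimage_linear:
  fixes f :: "'a::euclidean_space \<Rightarrow> 'a"
  assumes "linear f" "V \<in> sets borel"
  shows "f -` V \<in> sets borel"
proof -
  have "f \<in> borel_measurable borel"
    using assms by (intro borel_measurable_continuous_onI linear_continuous_on) (simp add: linear_linear)
  from measurable_sets[OF this assms(2)] show ?thesis by simp
qed

lemma cone_area_le:
  fixes V :: "(real^'n) set"
  assumes V: "V \<subseteq> sphere 0 1" "V \<noteq> {}" "V \<in> sets borel" and \<rho>: "0 < \<rho>" "\<rho> < 1"
    and diam: "\<And>x y. x \<in> V \<Longrightarrow> y \<in> V \<Longrightarrow> norm (x - y) \<le> \<rho>"
  shows "cone_area V
    \<le> unit_ball_vol (real (CARD('n) - 1)) * (distortion \<rho> * \<rho> / 2) ^ (CARD('n) - 1)"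
proof -
  obtain u where u: "u \<in> V" using V by auto
  then obtain e :: "real^'n" and f :: "real^'n \<Rightarrow> real^'n" where f: "e \<in> Basis" "linear f" "\<And>x. norm (f x) = norm x" "f e = u"
    using V by (metis exists_rotation_from_basis mem_sphere_0 subsetD)
  have "cone_area (f -` V)
    \<le> unit_ball_vol (real (DIM(real^'n) - 1)) * (distortion \<rho> * \<rho> / 2) ^ (DIM(real^'n) - 1)"
  proof (rule cone_area_le_axis[OF _ _ _ f(1) \<rho>])
    show "f -` V \<subseteq> sphere 0 1" using V(1) f(3) by (auto simp: subset_iff)
    show "e \<in> f -` V" using f u by simp
    show "f -` V \<in> sets borel" using borel_vimage_linear f(2) V(3) .
    show "norm (x - y) \<le> \<rho>" if "x \<in> f -` V" "y \<in> f -` V" for x y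
      using diam[of "f x" "f y"] that f(3)[of "x - y"] by (simp add: linear_diff[OF f(2)])
  qed
  then show ?thesis by (simp add: cone_area_vimage_linear_isometry[OF f(2,3) V(3)])
qed

text \<open>Covering sets in the Hausdorff content need not be Borel. The closure is Borel and has
  the same diameter, so passing to it costs nothing in the gauge.\<close>

lemma cone_area_le_gauge:
  fixes U :: "(real^'n) set"
  assumes U: "bounded U" "diameter U \<le> \<delta>" and \<delta>: "\<delta> < 1"
  shows "ennreal (cone_area (closure U \<inter> sphere 0 1))
    \<le> ennreal (distortion \<delta> ^ (CARD('n) - 1)) * hausdorff_gauge (CARD('n) - 1) U"
proof -
  define V where "V = closure U \<inter> sphere 0 1"
  define k where "k = CARD('n) - 1"
  let ?g = "\<lambda>\<rho>. unit_ball_vol (real k) * (distortion \<rho> * \<rho> / 2) ^ k"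
  show ?thesis
  proof (cases "V = {}")
    case True
    then have "cone_area V = 0" by (simp add: cone_area_def solid_cone_def)
    then show ?thesis unfolding V_def by simp
  next
    case False
    then have "U \<noteq> {}" by (auto simp: V_def)
    have V: "V \<subseteq> sphere 0 1" "V \<in> sets borel"
      by (auto simp: V_def)
    have dV: "norm (x - y) \<le> diameter U" if "x \<in> V" "y \<in> V" for x y
      using that diameter_bounded_bound[of "closure U" x y] U
      by (auto simp: V_def diameter_closure bounded_closure dist_norm)
    have d0: "0 \<le> diameter U" using diameter_ge_0 U by blast
    \<comment> \<open>\<open>cone_area_le\<close> needs a positive \<rho>, while the diameter may be
      0; hence the bound is taken for larger \<rho> and passed to the limit.\<close>
    have "cone_area V \<le> ?g (diameter U)"
    proof (rule tendsto_lowerbound)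
      show "(?g \<longlongrightarrow> ?g (diameter U)) (at_right (diameter U))"
        unfolding distortion_def using U \<delta> by (intro tendsto_intros) auto
      have "\<forall>\<^sub>F \<rho> in at_right (diameter U). \<rho> \<in> {diameter U<..<1}"
        using U \<delta> by (intro eventually_at_right_real) auto
      then show "\<forall>\<^sub>F \<rho> in at_right (diameter U). cone_area V \<le> ?g \<rho>"
      proof eventually_elim
        case (elim \<rho>)
        show ?case
          unfolding k_def
        proof (rule cone_area_le[OF V(1) False V(2)])
          show "norm (x - y) \<le> \<rho>" if "x \<in> V" "y \<in> V" for x y
            using dV[OF that] elim by simp
        qed (use elim d0 in auto)
      qed
    qed simp
    also have "\<dots> \<le> distortion \<delta> ^ k * (unit_ball_vol (real k) * (diameter U / 2) ^ k)"
    proof -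
      have "distortion (diameter U) ^ k \<le> distortion \<delta> ^ k"
        using U \<delta> d0 distortion_ge_1[of "diameter U"] by (intro power_mono distortion_mono) auto
      then have "distortion (diameter U) ^ k * (unit_ball_vol (real k) * (diameter U / 2) ^ k)
          \<le> distortion \<delta> ^ k * (unit_ball_vol (real k) * (diameter U / 2) ^ k)"
        using d0 by (intro mult_right_mono) auto
      then show ?thesis by (simp add: power_mult_distrib power_divide mult_ac)
    qed
    finally have "ennreal (cone_area V)
        \<le> ennreal (distortion \<delta> ^ k * (unit_ball_vol (real k) * (diameter U / 2) ^ k))"
      by (rule ennreal_leI)
    also have "\<dots> = ennreal (distortion \<delta> ^ k) * hausdorff_gauge k U"
      using \<open>U \<noteq> {}\<close> d0 U \<delta> distortion_ge_1[of \<delta>]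
      by (simp add: hausdorff_gauge_def ennreal_mult)
    finally show ?thesis by (simp add: V_def k_def)
  qed
qed

lemma cone_area_le_content:
  assumes \<delta>: "0 < \<delta>" "\<delta> < 1"
  shows "ennreal (cone_area (sphere (0::real^'n) 1))
    \<le> ennreal (distortion \<delta> ^ (CARD('n) - 1)) * hausdorff_content \<delta> (CARD('n) - 1) (sphere (0::real^'n) 1)"
proof -
  let ?k = "CARD('n) - 1" and ?S = "sphere (0::real^'n) 1"
  have "0 < distortion \<delta> ^ ?k"
    using distortion_ge_1[of \<delta>] \<delta> by (intro zero_less_power) simp
  then have D: "ennreal (distortion \<delta> ^ ?k) \<noteq> 0" "ennreal (distortion \<delta> ^ ?k) \<noteq> top"
    by (simp_all only: ennreal_eq_0_iff ennreal_neq_top not_le not_False_eq_True)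
  \<comment> \<open>Dividing by the distortion isolates the infimum over covers on the right, where
    it can be tested cover by cover.\<close>
  have "ennreal (cone_area ?S) / ennreal (distortion \<delta> ^ ?k) \<le> hausdorff_content \<delta> ?k ?S"
    unfolding hausdorff_content_def
  proof (rule INF_greatest)
    fix U :: "nat \<Rightarrow> (real^'n) set"
    assume "U \<in> {U. ?S \<subseteq> (\<Union>i. U i) \<and> (\<forall>i. bounded (U i) \<and> diameter (U i) \<le> \<delta>)}"
    then have U: "?S \<subseteq> (\<Union>i. U i)" "\<And>i. bounded (U i)" "\<And>i. diameter (U i) \<le> \<delta>"
      by blast+
    have "ennreal (cone_area ?S) \<le> (\<Sum>i. ennreal (cone_area (closure (U i) \<inter> ?S)))"
    proof (rule cone_area_subadditive)
      show "?S \<subseteq> (\<Union>i. closure (U i) \<inter> ?S)" using U(1) closure_subset by blast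
    qed auto
    also have "\<dots> \<le> (\<Sum>i. ennreal (distortion \<delta> ^ ?k) * hausdorff_gauge ?k (U i))"
      using U \<delta> by (intro suminf_le cone_area_le_gauge) auto
    finally have "ennreal (cone_area ?S) \<le> ennreal (distortion \<delta> ^ ?k) * (\<Sum>i. hausdorff_gauge ?k (U i))"
      by simp
    then show "ennreal (cone_area ?S) / ennreal (distortion \<delta> ^ ?k) \<le> (\<Sum>i. hausdorff_gauge ?k (U i))"
      using D by (simp add: divide_le_posI_ennreal mult.commute zero_less_iff_neq_zero)
  qed
  then have "ennreal (distortion \<delta> ^ ?k) * (ennreal (cone_area ?S) / ennreal (distortion \<delta> ^ ?k))
    \<le> ennreal (distortion \<delta> ^ ?k) * hausdorff_content \<delta> ?k ?S"
    by (rule mult_left_mono) simp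
  then show ?thesis
    using D by (simp add: ennreal_times_divide ennreal_mult_divide_eq mult.commute)
qed

lemma cone_area_sphere_le_hausdorff:
  "ennreal (cone_area (sphere (0::real^'n) 1)) \<le> hausdorff_measure (CARD('n) - 1) (sphere (0::real^'n) 1)"
proof (rule tendsto_lowerbound)
  let ?k = "CARD('n) - 1" and ?S = "sphere (0::real^'n) 1"
  have "((\<lambda>\<delta>. distortion \<delta> ^ ?k) \<longlongrightarrow> distortion 0 ^ ?k) (at_right 0)"
    unfolding distortion_def by (intro tendsto_intros) auto
  then have "((\<lambda>\<delta>. ennreal (distortion \<delta> ^ ?k)) \<longlongrightarrow> ennreal 1) (at_right 0)"
    by (intro tendsto_ennrealI) (simp add: distortion_def)
  then have "((\<lambda>\<delta>. ennreal (distortion \<delta> ^ ?k) * hausdorff_measure ?k ?S)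
      \<longlongrightarrow> ennreal 1 * hausdorff_measure ?k ?S) (at_right 0)"
    by (intro tendsto_mult_ennreal tendsto_const) auto
  then show "((\<lambda>\<delta>. ennreal (distortion \<delta> ^ ?k) * hausdorff_measure ?k ?S)
      \<longlongrightarrow> hausdorff_measure ?k ?S) (at_right 0)" by simp
  have "\<forall>\<^sub>F \<delta> in at_right (0::real). \<delta> \<in> {0<..<1}"
    by (intro eventually_at_right_real) auto
  then show "\<forall>\<^sub>F \<delta> in at_right 0. ennreal (cone_area ?S) \<le> ennreal (distortion \<delta> ^ ?k) * hausdorff_measure ?k ?S"
  proof eventually_elim
    case (elim \<delta>)
    have "ennreal (cone_area ?S) \<le> ennreal (distortion \<delta> ^ ?k) * hausdorff_content \<delta> ?k ?S"
      using elim by (intro cone_area_le_content) auto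
    also have "\<dots> \<le> ennreal (distortion \<delta> ^ ?k) * hausdorff_measure ?k ?S"
      unfolding hausdorff_measure_def using elim by (intro mult_left_mono SUP_upper) auto
    finally show ?case .
  qed
qed simp

text \<open>The cap consists of the unit vectors with height at least c = 1 - r * r / 2. A round
  cone of slope r and height c fits into the cone over it: a point y at height t has norm at most t
  times the root of 1 + r * r, and \<open>c2\<close> turns this into c * norm y \<le> t. So the
  direction of y lies in the cap, and t \<le> c gives norm y \<le> 1.\<close>

lemma cone_area_cap_ge_axis:
  fixes e :: "'a::euclidean_space"
  assumes e: "e \<in> Basis" and r: "0 < r" "r \<le> 1"
  shows "cone_area (cball e r \<inter> sphere 0 1)
    \<ge> unit_ball_vol (real (DIM('a) - 1)) * r ^ (DIM('a) - 1) * (1 - r\<^sup>2 / 2) ^ DIM('a)"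
proof -
  define c where "c = 1 - r\<^sup>2 / 2"
  let ?V = "cball e r \<inter> sphere 0 1"
  let ?R = "unit_ball_vol (real (DIM('a) - 1)) * r ^ (DIM('a) - 1) * c ^ DIM('a)"
  have "r\<^sup>2 \<le> 1" using r by (intro power_le_one) auto
  then have c: "0 < c" "c \<le> 1" by (auto simp: c_def)
  have c2: "c\<^sup>2 * (1 + r\<^sup>2) \<le> 1"
  proof -
    have "c\<^sup>2 * (1 + r\<^sup>2) = 1 - r^4 * (3 - r\<^sup>2) / 4"
      unfolding c_def by (simp add: power2_eq_square power4_eq_xxxx field_simps)
    also have "\<dots> \<le> 1" using \<open>r\<^sup>2 \<le> 1\<close> by simp
    finally show ?thesis .
  qed
  have "round_cone e r c \<subseteq> solid_cone ?V \<union> {0}"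
  proof
    fix y assume y: "y \<in> round_cone e r c"
    define t where "t = y \<bullet> e"
    have t: "0 \<le> t" "t \<le> c" "(\<Sum>b\<in>Basis - {e}. (y \<bullet> b)\<^sup>2) \<le> (r * t)\<^sup>2"
      using y by (auto simp: round_cone_def t_def)
    have "(norm y)\<^sup>2 = (\<Sum>b\<in>Basis. (y \<bullet> b)\<^sup>2)"
      unfolding power2_norm_eq_inner by (subst euclidean_inner) (simp add: power2_eq_square)
    also have "\<dots> = t\<^sup>2 + (\<Sum>b\<in>Basis - {e}. (y \<bullet> b)\<^sup>2)"
      using e by (subst sum.remove[of _ e]) (auto simp: t_def)
    also have "\<dots> \<le> t\<^sup>2 * (1 + r\<^sup>2)"
      using t by (simp add: power_mult_distrib algebra_simps)
    finally have "c\<^sup>2 * (norm y)\<^sup>2 \<le> c\<^sup>2 * (t\<^sup>2 * (1 + r\<^sup>2))" by (rule mult_left_mono) simp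
    also have "\<dots> = t\<^sup>2 * (c\<^sup>2 * (1 + r\<^sup>2))" by simp
    also have "\<dots> \<le> t\<^sup>2 * 1" using c2 by (intro mult_left_mono) auto
    finally have "(c * norm y)\<^sup>2 \<le> t\<^sup>2" by (simp add: power_mult_distrib)
    then have ct: "c * norm y \<le> t" using t(1) by (rule power2_le_imp_le)
    show "y \<in> solid_cone ?V \<union> {0}"
    proof (cases "y = 0")
      case False
      have "c * norm y \<le> c * 1" using ct t by simp
      then have ny: "norm y \<le> 1" using c by (simp only: mult_le_cancel_left_pos)
      have "c \<le> t / norm y" using ct False by (simp add: field_simps)
      moreover have "(norm (y /\<^sub>R norm y - e))\<^sup>2 = 2 - 2 * (t / norm y)"
        using False e by (subst power2_norm_diff_of_unit) (simp_all add: t_def divide_inverse mult.commute)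
      ultimately have "(norm (y /\<^sub>R norm y - e))\<^sup>2 \<le> r\<^sup>2" by (simp add: c_def)
      then have "norm (y /\<^sub>R norm y - e) \<le> r" by (rule power2_le_imp_le) (use r in simp)
      then show ?thesis
        using False ny by (auto simp: solid_cone_def dist_norm norm_minus_commute)
    qed simp
  qed
  then have "emeasure lborel (round_cone e r c) \<le> emeasure lborel (solid_cone ?V \<union> {0})"
    by (rule emeasure_mono) simp
  also have "\<dots> = emeasure lborel (solid_cone ?V)"
    by (rule emeasure_Un_null_set) auto
  finally have "ennreal DIM('a) * emeasure lborel (round_cone e r c) \<le> ennreal (cone_area ?V)"
    by (subst ennreal_cone_area) (auto intro!: mult_left_mono)
  moreover have "ennreal DIM('a) * emeasure lborel (round_cone e r c) = ennreal ?R"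
    using e r c by (subst emeasure_round_cone) (auto simp: ennreal_mult[symmetric])
  ultimately show ?thesis by (simp add: c_def)
qed

lemma cone_area_cap_ge:
  fixes u :: "real^'n"
  assumes u: "norm u = 1" and r: "0 < r" "r \<le> 1"
  shows "cone_area (cball u r \<inter> sphere 0 1)
    \<ge> unit_ball_vol (real (CARD('n) - 1)) * r ^ (CARD('n) - 1) * (1 - r\<^sup>2 / 2) ^ CARD('n)"
proof -
  obtain e :: "real^'n" and f :: "real^'n \<Rightarrow> real^'n" where f: "e \<in> Basis" "linear f" "\<And>x. norm (f x) = norm x" "f e = u"
    using exists_rotation_from_basis[OF u] by blast
  have "dist u (f x) = dist e x" for x
    using f(3)[of "e - x"] by (simp add: dist_norm linear_diff[OF f(2)] f(4))
  then have "f -` (cball u r \<inter> sphere 0 1) = cball e r \<inter> sphere 0 1"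
    using f(3) by auto
  then have "cone_area (cball u r \<inter> sphere 0 1) = cone_area (cball e r \<inter> sphere 0 1)"
    using cone_area_vimage_linear_isometry[OF f(2,3), of "cball u r \<inter> sphere 0 1"] by simp
  then show ?thesis using cone_area_cap_ge_axis[OF f(1) r] by simp
qed

section \<open>Hausdorff contents and covers by caps\<close>

lemma hausdorff_gauge_empty [simp]: "hausdorff_gauge k {} = 0"
  by (simp add: hausdorff_gauge_def)

lemma hausdorff_gauge_cball:
  fixes u :: "'a::euclidean_space"
  assumes "0 \<le> r"
  shows "hausdorff_gauge k (cball u r) = ennreal (unit_ball_vol (real k) * r ^ k)"
  using assms by (simp add: hausdorff_gauge_def)

lemma hausdorff_content_le:
  assumes "A \<subseteq> (\<Union>i. U i)" "\<And>i. bounded (U i)" "\<And>i. diameter (U i) \<le> \<delta>"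
  shows "hausdorff_content \<delta> k A \<le> (\<Sum>i. hausdorff_gauge k (U i))"
  unfolding hausdorff_content_def using assms by (intro INF_lower) auto

lemma hausdorff_content_mono: "A \<subseteq> B \<Longrightarrow> hausdorff_content \<delta> k A \<le> hausdorff_content \<delta> k B"
  unfolding hausdorff_content_def by (intro INF_superset_mono) auto

lemma hausdorff_content_antimono:
  "\<delta> \<le> \<delta>' \<Longrightarrow> hausdorff_content \<delta>' k A \<le> hausdorff_content \<delta> k A"
  unfolding hausdorff_content_def by (intro INF_superset_mono) (auto intro: order_trans)

lemma hausdorff_content_Un_le:
  assumes C: "bounded C" "diameter C \<le> \<delta>"
  shows "hausdorff_content \<delta> k (C \<union> B) \<le> hausdorff_gauge k C + hausdorff_content \<delta> k B"
proof -
  \<comment> \<open>The finite gauge of \<open>C\<close> goes to the left, which leaves the infimum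
    over covers of \<open>B\<close> alone on the right. Each such cover is extended by putting
    \<open>C\<close> in front.\<close>
  have "hausdorff_content \<delta> k (C \<union> B) - hausdorff_gauge k C \<le> hausdorff_content \<delta> k B"
    unfolding hausdorff_content_def[of \<delta> k B]
  proof (rule INF_greatest)
    fix V :: "nat \<Rightarrow> 'a set"
    assume "V \<in> {V. B \<subseteq> (\<Union>i. V i) \<and> (\<forall>i. bounded (V i) \<and> diameter (V i) \<le> \<delta>)}"
    then have V: "B \<subseteq> (\<Union>i. V i)" "\<And>i. bounded (V i)" "\<And>i. diameter (V i) \<le> \<delta>"
      by blast+
    let ?W = "case_nat C V"
    have "hausdorff_content \<delta> k (C \<union> B) \<le> (\<Sum>i. hausdorff_gauge k (?W i))"
    proof (rule hausdorff_content_le)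
      show "C \<union> B \<subseteq> (\<Union>i. ?W i)"
      proof
        fix x assume "x \<in> C \<union> B"
        then consider "x \<in> ?W 0" | i where "x \<in> ?W (Suc i)" using V(1) by auto
        then show "x \<in> (\<Union>i. ?W i)" by cases (rule UN_I[OF UNIV_I], assumption)+
      qed
    qed (use C V in \<open>auto split: nat.splits\<close>)
    also have "\<dots> \<le> hausdorff_gauge k C + (\<Sum>i. hausdorff_gauge k (V i))"
    proof (rule suminf_le_const[OF summableI])
      fix n
      have "(\<Sum>i<n. hausdorff_gauge k (?W i)) \<le> (\<Sum>i<Suc n. hausdorff_gauge k (?W i))"
        by (intro sum_mono2) auto
      also have "\<dots> = hausdorff_gauge k C + (\<Sum>i<n. hausdorff_gauge k (V i))"
        by (subst sum.lessThan_Suc_shift) simp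
      also have "\<dots> \<le> hausdorff_gauge k C + (\<Sum>i. hausdorff_gauge k (V i))"
        by (intro add_left_mono sum_le_suminf) auto
      finally show "(\<Sum>i<n. hausdorff_gauge k (?W i))
        \<le> hausdorff_gauge k C + (\<Sum>i. hausdorff_gauge k (V i))" .
    qed
    finally show "hausdorff_content \<delta> k (C \<union> B) - hausdorff_gauge k C \<le> (\<Sum>i. hausdorff_gauge k (V i))"
      by (simp add: ennreal_minus_le_iff hausdorff_gauge_def)
  qed
  then show ?thesis by (simp add: ennreal_minus_le_iff)
qed

lemma hausdorff_content_UN_Un_le:
  assumes "finite F" "\<And>i. i \<in> F \<Longrightarrow> bounded (C i)" "\<And>i. i \<in> F \<Longrightarrow> diameter (C i) \<le> \<delta>"
  shows "hausdorff_content \<delta> k ((\<Union>i\<in>F. C i) \<union> B)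
    \<le> (\<Sum>i\<in>F. hausdorff_gauge k (C i)) + hausdorff_content \<delta> k B"
  using assms
proof (induction F rule: finite_induct)
  case (insert a F)
  have "hausdorff_content \<delta> k (C a \<union> ((\<Union>i\<in>F. C i) \<union> B))
    \<le> hausdorff_gauge k (C a) + hausdorff_content \<delta> k ((\<Union>i\<in>F. C i) \<union> B)"
    using insert by (intro hausdorff_content_Un_le) auto
  also have "\<dots> \<le> hausdorff_gauge k (C a) + ((\<Sum>i\<in>F. hausdorff_gauge k (C i)) + hausdorff_content \<delta> k B)"
    using insert by (intro add_left_mono insert.IH) auto
  finally show ?case using insert by (simp add: Un_assoc add.assoc)
qed simp

text \<open>Openness of \<open>G\<close> provides small balls inside \<open>G\<close> around every
  point of \<open>S \<inter> G\<close>, to which Vitali's lemma applies. The selected balls stay in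
  \<open>G\<close>, but their enlargements may leave it. Indexing by naturals makes the later sums
  ordinary series.\<close>

lemma Vitali_caps:
  fixes S :: "'a::euclidean_space set"
  assumes "open G" "0 < R"
  obtains I :: "nat set" and a r where
    "\<And>i. i \<in> I \<Longrightarrow> a i \<in> S" "\<And>i. i \<in> I \<Longrightarrow> 0 < r i" "\<And>i. i \<in> I \<Longrightarrow> r i \<le> R"
    "\<And>i. i \<in> I \<Longrightarrow> cball (a i) (r i) \<subseteq> G"
    "disjoint_family_on (\<lambda>i. cball (a i) (r i)) I"
    "S \<inter> G \<subseteq> (\<Union>i\<in>I. cball (a i) (5 * r i))"
proof -
  define K where "K = {(x, \<rho>). x \<in> S \<and> 0 < \<rho> \<and> \<rho> \<le> R \<and> cball x \<rho> \<subseteq> G}"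
  have "S \<inter> G \<subseteq> (\<Union>p\<in>K. cball (fst p) (snd p))"
  proof
    fix x assume x: "x \<in> S \<inter> G"
    then obtain \<epsilon> where "0 < \<epsilon>" "cball x \<epsilon> \<subseteq> G" using \<open>open G\<close> open_contains_cball by blast
    then have "(x, min \<epsilon> R) \<in> K" using x \<open>0 < R\<close> by (auto simp: K_def)
    then show "x \<in> (\<Union>p\<in>K. cball (fst p) (snd p))"
      using \<open>0 < \<epsilon>\<close> \<open>0 < R\<close> by (intro UN_I[of "(x, min \<epsilon> R)"]) auto
  qed
  moreover have "\<And>p. p \<in> K \<Longrightarrow> 0 < snd p \<and> snd p \<le> R" by (auto simp: K_def)
  ultimately obtain C where C: "countable C" "C \<subseteq> K"
     "pairwise (\<lambda>i j. disjnt (cball (fst i) (snd i)) (cball (fst j) (snd j))) C"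
     "S \<inter> G \<subseteq> (\<Union>i\<in>C. cball (fst i) (5 * snd i))"
    by (rule Vitali_covering_lemma_cballs[where S="S \<inter> G" and K=K and a=fst and r=snd and B=R])
  define I g where "I = to_nat_on C ` C" and "g = from_nat_into C"
  have gI: "g i \<in> C" if "i \<in> I" for i
    using that C(1) by (auto simp: I_def g_def)
  have gK: "fst (g i) \<in> S \<and> 0 < snd (g i) \<and> snd (g i) \<le> R \<and> cball (fst (g i)) (snd (g i)) \<subseteq> G"
    if "i \<in> I" for i
    using gI[OF that] C(2) by (force simp: K_def)
  have inj: "inj_on g I"
    by (rule inj_onI) (use C(1) in \<open>auto simp: I_def g_def\<close>)
  have surj: "C \<subseteq> g ` I"
    using C(1) by (auto simp: I_def g_def image_image)
  show ?thesis
  proof (rule that[of I "\<lambda>i. fst (g i)" "\<lambda>i. snd (g i)"])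
    show "disjoint_family_on (\<lambda>i. cball (fst (g i)) (snd (g i))) I"
      unfolding disjoint_family_on_def
    proof (intro ballI impI)
      fix i j assume ij: "i \<in> I" "j \<in> I" "i \<noteq> j"
      then have "g i \<noteq> g j" using inj by (meson inj_onD)
      then show "cball (fst (g i)) (snd (g i)) \<inter> cball (fst (g j)) (snd (g j)) = {}"
        using pairwiseD[OF C(3) gI[OF ij(1)] gI[OF ij(2)]] by (simp add: disjnt_def)
    qed
    show "S \<inter> G \<subseteq> (\<Union>i\<in>I. cball (fst (g i)) (5 * snd (g i)))"
      using C(4) surj by fastforce
  qed (use gK in blast)+
qed

text \<open>The assumption \<open>cap\<close> bounds the gauge of a small ball by nearly the area of
  its cap. \<open>10 * R \<le> \<delta>\<close> makes the fivefold enlargements admissible for the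
  content, their diameters being at most \<open>10 * R\<close>.\<close>

locale cap_estimate =
  fixes \<delta> \<eta> R :: real and S :: "(real^'n) set" and k :: nat
  assumes S_def: "S = sphere 0 1" and k_def: "k = CARD('n) - 1"
    and \<delta>: "0 < \<delta>" "\<delta> < 1" and \<eta>: "0 < \<eta>" and R: "0 < R" "10 * R \<le> \<delta>"
    and cap: "\<And>u r. norm u = 1 \<Longrightarrow> 0 < r \<Longrightarrow> r \<le> R \<Longrightarrow>
      unit_ball_vol (real k) * r ^ k \<le> (1 + \<eta>) * cone_area (cball u r \<inter> S)"
begin

lemma S_borel [measurable, simp]: "S \<in> sets borel"
  by (simp add: S_def)

lemma caps_area_le:
  assumes "finite F" "\<And>i. i \<in> F \<Longrightarrow> cball (a i) (r i) \<subseteq> G" "open G"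
    "disjoint_family_on (\<lambda>i. cball (a i) (r i)) F"
  shows "(\<Sum>i\<in>F. cone_area (cball (a i) (r i) \<inter> S)) \<le> cone_area (S \<inter> G)"
proof -
  have "(\<Sum>i\<in>F. cone_area (cball (a i) (r i) \<inter> S)) = cone_area (\<Union>i\<in>F. cball (a i) (r i) \<inter> S)"
  proof (rule cone_area_UN_disjoint[symmetric, OF assms(1)])
    show "disjoint_family_on (\<lambda>i. cball (a i) (r i) \<inter> S) F"
      using assms(4) unfolding disjoint_family_on_def by blast
  qed auto
  also have "\<dots> \<le> cone_area (S \<inter> G)"
    using assms by (intro cone_area_mono) (auto intro!: sets.finite_UN)
  finally show ?thesis .
qed

text \<open>The crude bound that starts the iteration: the enlarged balls cover, their gauges are
  5^k times those of the disjoint originals, and these have total cap area at most that of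
  \<open>S \<inter> G\<close>.\<close>

lemma content_le_initial:
  assumes "open G"
  shows "hausdorff_content \<delta> k (S \<inter> G) \<le> ennreal (5 ^ k * (1 + \<eta>) * cone_area (S \<inter> G))"
proof -
  obtain I a r where I: "\<And>i. i \<in> I \<Longrightarrow> a i \<in> S" "\<And>i. i \<in> I \<Longrightarrow> 0 < r i" "\<And>i. i \<in> I \<Longrightarrow> r i \<le> R"
    "\<And>i. i \<in> I \<Longrightarrow> cball (a i) (r i) \<subseteq> G"
    "disjoint_family_on (\<lambda>i. cball (a i) (r i)) (I :: nat set)"
    "S \<inter> G \<subseteq> (\<Union>i\<in>I. cball (a i) (5 * r i))"
    by (rule Vitali_caps[OF assms R(1), where S = S]) blast
  define W where "W i = (if i \<in> I then cball (a i) (5 * r i) else {})" for i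
  have "hausdorff_content \<delta> k (S \<inter> G) \<le> (\<Sum>i. hausdorff_gauge k (W i))"
  proof (rule hausdorff_content_le)
    show "S \<inter> G \<subseteq> (\<Union>i. W i)" using I(6) by (fastforce simp: W_def)
    show "bounded (W i)" for i by (simp add: W_def)
    show "diameter (W i) \<le> \<delta>" for i
      using I(2,3)[of i] R \<delta> by (auto simp: W_def)
  qed
  also have "\<dots> \<le> (\<Sum>i. ennreal (5 ^ k * (1 + \<eta>) * (if i \<in> I then cone_area (cball (a i) (r i) \<inter> S) else 0)))"
  proof (intro suminf_le summableI)
    fix i
    show "hausdorff_gauge k (W i)
      \<le> ennreal (5 ^ k * (1 + \<eta>) * (if i \<in> I then cone_area (cball (a i) (r i) \<inter> S) else 0))"
    proof (cases "i \<in> I")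
      case True
      have "5 ^ k * (unit_ball_vol (real k) * r i ^ k) \<le> 5 ^ k * ((1 + \<eta>) * cone_area (cball (a i) (r i) \<inter> S))"
        using I(1-3)[OF True] by (intro mult_left_mono cap) (auto simp: S_def)
      then show ?thesis
        using True I(2)[OF True]
        by (auto simp: W_def hausdorff_gauge_cball power_mult_distrib mult_ac intro!: ennreal_leI)
    qed (simp add: W_def)
  qed
  also have "\<dots> \<le> ennreal (5 ^ k * (1 + \<eta>) * cone_area (S \<inter> G))"
  proof (rule suminf_le_const[OF summableI])
    fix n
    have "(\<Sum>i<n. if i \<in> I then cone_area (cball (a i) (r i) \<inter> S) else 0)
        = (\<Sum>i\<in>{..<n} \<inter> I. cone_area (cball (a i) (r i) \<inter> S))"
      by (simp add: sum.inter_restrict)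
    also have "\<dots> \<le> cone_area (S \<inter> G)"
      using I assms by (intro caps_area_le) (auto intro: disjoint_family_on_mono[OF _ I(5)])
    finally have "5 ^ k * (1 + \<eta>) * (\<Sum>i<n. if i \<in> I then cone_area (cball (a i) (r i) \<inter> S) else 0)
        \<le> 5 ^ k * (1 + \<eta>) * cone_area (S \<inter> G)"
      using \<eta> by (intro mult_left_mono) auto
    then show "(\<Sum>i<n. ennreal (5 ^ k * (1 + \<eta>) * (if i \<in> I then cone_area (cball (a i) (r i) \<inter> S) else 0)))
        \<le> ennreal (5 ^ k * (1 + \<eta>) * cone_area (S \<inter> G))"
      using \<eta> by (subst sum_ennreal) (auto simp: sum_distrib_left intro!: ennreal_leI)
  qed
  finally show ?thesis .
qed

text \<open>Fivefold enlargement multiplies cap areas by at most twice the denominator's half, (5 *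
  distortion)^k * (1 + \<eta>). The original caps thus fill at least the reciprocal fraction, and
  halving it leaves room for passing to a finite subfamily.\<close>

definition \<theta> :: real where
  "\<theta> = 1 / (2 * ((5 * distortion \<delta>) ^ k * (1 + \<eta>)))"

lemma \<theta>: "0 < \<theta>" "\<theta> \<le> 1"
proof -
  have "1 * 1 \<le> (5 * distortion \<delta>) ^ k * (1 + \<eta>)"
    using distortion_ge_1[of \<delta>] \<delta> \<eta> by (intro mult_mono one_le_power) auto
  then show "0 < \<theta>" "\<theta> \<le> 1" by (simp_all add: \<theta>_def)
qed

text \<open>If every finite subfamily of the Vitali caps stayed below the fraction
  \<open>\<theta>\<close>, so would the whole series. The enlarged caps, which cover
  \<open>S \<inter> G\<close>, would then have at most half the area of
  \<open>S \<inter> G\<close>.\<close>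

lemma exists_caps:
  assumes "open G"
  obtains F :: "nat set" and a r where "finite F"
    "\<And>i. i \<in> F \<Longrightarrow> a i \<in> S" "\<And>i. i \<in> F \<Longrightarrow> 0 < r i" "\<And>i. i \<in> F \<Longrightarrow> r i \<le> R"
    "\<And>i. i \<in> F \<Longrightarrow> cball (a i) (r i) \<subseteq> G"
    "disjoint_family_on (\<lambda>i. cball (a i) (r i)) F"
    "\<theta> * cone_area (S \<inter> G) \<le> (\<Sum>i\<in>F. cone_area (cball (a i) (r i) \<inter> S))"
proof -
  obtain I a r where I: "\<And>i. i \<in> I \<Longrightarrow> a i \<in> S" "\<And>i. i \<in> I \<Longrightarrow> 0 < r i" "\<And>i. i \<in> I \<Longrightarrow> r i \<le> R"
    "\<And>i. i \<in> I \<Longrightarrow> cball (a i) (r i) \<subseteq> G"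
    "disjoint_family_on (\<lambda>i. cball (a i) (r i)) (I :: nat set)"
    "S \<inter> G \<subseteq> (\<Union>i\<in>I. cball (a i) (5 * r i))"
    by (rule Vitali_caps[OF assms R(1), where S = S]) blast
  have "\<exists>F. finite F \<and> F \<subseteq> I \<and> \<theta> * cone_area (S \<inter> G) \<le> (\<Sum>i\<in>F. cone_area (cball (a i) (r i) \<inter> S))"
  proof (rule ccontr)
    assume "\<not> ?thesis"
    then have small: "\<And>F. finite F \<Longrightarrow> F \<subseteq> I \<Longrightarrow>
      (\<Sum>i\<in>F. cone_area (cball (a i) (r i) \<inter> S)) < \<theta> * cone_area (S \<inter> G)"
      by (meson not_le)
    define L where "L = (5 * distortion \<delta>) ^ k * (1 + \<eta>)"
    have D: "1 \<le> distortion \<delta>" using distortion_ge_1 \<delta> by auto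
    have L: "0 < L" using D \<eta> by (simp add: L_def)
    define W where "W i = (if i \<in> I then cball (a i) (5 * r i) \<inter> S else {})" for i
    have "ennreal (cone_area (S \<inter> G)) \<le> (\<Sum>i. ennreal (cone_area (W i)))"
    proof (rule cone_area_subadditive)
      show "S \<inter> G \<subseteq> (\<Union>i. W i)" using I(6) by (fastforce simp: W_def)
    qed (use assms in \<open>auto simp: W_def\<close>)
    also have "\<dots> \<le> (\<Sum>i. ennreal (L * (if i \<in> I then cone_area (cball (a i) (r i) \<inter> S) else 0)))"
    proof (intro suminf_le summableI)
      fix i
      show "ennreal (cone_area (W i))
        \<le> ennreal (L * (if i \<in> I then cone_area (cball (a i) (r i) \<inter> S) else 0))"
      proof (cases "i \<in> I")
        case True
        note i = I(1-3)[OF True]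
        have "ennreal (cone_area (closure (cball (a i) (5 * r i)) \<inter> sphere 0 1))
          \<le> ennreal (distortion \<delta> ^ k) * hausdorff_gauge k (cball (a i) (5 * r i))"
          unfolding k_def using i R \<delta> by (intro cone_area_le_gauge) auto
        also have "\<dots> = ennreal ((5 * distortion \<delta>) ^ k * (unit_ball_vol (real k) * r i ^ k))"
          using i D by (simp add: hausdorff_gauge_cball power_mult_distrib ennreal_mult[symmetric] mult_ac)
        also have "\<dots> \<le> ennreal ((5 * distortion \<delta>) ^ k * ((1 + \<eta>) * cone_area (cball (a i) (r i) \<inter> S)))"
          using i D by (intro ennreal_leI mult_left_mono cap) (auto simp: S_def)
        finally show ?thesis using True by (simp add: W_def S_def L_def mult.assoc)
      qed (simp add: W_def cone_area_def solid_cone_def)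
    qed
    also have "\<dots> \<le> ennreal (L * (\<theta> * cone_area (S \<inter> G)))"
    proof (rule suminf_le_const[OF summableI])
      fix n
      have "(\<Sum>i<n. if i \<in> I then cone_area (cball (a i) (r i) \<inter> S) else 0)
          = (\<Sum>i\<in>{..<n} \<inter> I. cone_area (cball (a i) (r i) \<inter> S))"
        by (simp add: sum.inter_restrict)
      also have "\<dots> \<le> \<theta> * cone_area (S \<inter> G)"
        using small[of "{..<n} \<inter> I"] by simp
      finally have "L * (\<Sum>i<n. if i \<in> I then cone_area (cball (a i) (r i) \<inter> S) else 0)
          \<le> L * (\<theta> * cone_area (S \<inter> G))"
        using L by (intro mult_left_mono) auto
      then show "(\<Sum>i<n. ennreal (L * (if i \<in> I then cone_area (cball (a i) (r i) \<inter> S) else 0)))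
          \<le> ennreal (L * (\<theta> * cone_area (S \<inter> G)))"
        using L by (subst sum_ennreal) (auto simp: sum_distrib_left intro!: ennreal_leI)
    qed
    also have "L * (\<theta> * cone_area (S \<inter> G)) = cone_area (S \<inter> G) / 2"
      using L unfolding \<theta>_def L_def[symmetric] by simp
    finally have "cone_area (S \<inter> G) \<le> cone_area (S \<inter> G) / 2"
      by (subst (asm) ennreal_le_iff) auto
    \<comment> \<open>In the case of zero area the empty subfamily already suffices.\<close>
    then have "cone_area (S \<inter> G) = 0" using cone_area_nonneg[of "S \<inter> G"] by linarith
    with small[of "{}"] show False by simp
  qed
  then obtain F where F: "finite F" "F \<subseteq> I"
    "\<theta> * cone_area (S \<inter> G) \<le> (\<Sum>i\<in>F. cone_area (cball (a i) (r i) \<inter> S))"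
    by blast
  show ?thesis
  proof (rule that[of F a r])
    show "disjoint_family_on (\<lambda>i. cball (a i) (r i)) F"
      by (rule disjoint_family_on_mono[OF F(2) I(5)])
  qed (use F I(1-4) in blast)+
qed

text \<open>The caps have total area s, at least the fraction \<open>\<theta>\<close> of the whole.
  They are charged at rate \<open>1 + \<eta>\<close> and only the rest at rate \<open>M\<close>,
  which saves \<open>M - (1 + \<eta>)\<close> per unit of s.\<close>

lemma content_le_improve:
  assumes M: "\<And>G. open G \<Longrightarrow> hausdorff_content \<delta> k (S \<inter> G) \<le> ennreal (M * cone_area (S \<inter> G))"
    and ge: "1 + \<eta> \<le> M" and G: "open G"
  shows "hausdorff_content \<delta> k (S \<inter> G) \<le> ennreal ((M - \<theta> * (M - (1 + \<eta>))) * cone_area (S \<inter> G))"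
proof -
  obtain F a r where F: "finite (F :: nat set)"
    "\<And>i. i \<in> F \<Longrightarrow> a i \<in> S" "\<And>i. i \<in> F \<Longrightarrow> 0 < r i" "\<And>i. i \<in> F \<Longrightarrow> r i \<le> R"
    "\<And>i. i \<in> F \<Longrightarrow> cball (a i) (r i) \<subseteq> G"
    "disjoint_family_on (\<lambda>i. cball (a i) (r i)) F"
    "\<theta> * cone_area (S \<inter> G) \<le> (\<Sum>i\<in>F. cone_area (cball (a i) (r i) \<inter> S))"
    by (rule exists_caps[OF G]) blast
  define s where "s = (\<Sum>i\<in>F. cone_area (cball (a i) (r i) \<inter> S))"
  \<comment> \<open>Only finitely many closed balls are removed, so the remaining set is open and
    the hypothesis on \<open>M\<close> applies to it again.\<close>
  define G' where "G' = G - (\<Union>i\<in>F. cball (a i) (r i))"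
  have G': "open G'" unfolding G'_def using G F(1) by (intro open_Diff closed_UN) auto
  have s_eq: "s = cone_area (\<Union>i\<in>F. cball (a i) (r i) \<inter> S)"
    unfolding s_def
  proof (rule cone_area_UN_disjoint[symmetric, OF F(1)])
    show "disjoint_family_on (\<lambda>i. cball (a i) (r i) \<inter> S) F"
      using F(6) unfolding disjoint_family_on_def by blast
  qed auto
  have split: "cone_area (S \<inter> G) = s + cone_area (S \<inter> G')"
  proof -
    have "cone_area ((\<Union>i\<in>F. cball (a i) (r i) \<inter> S) \<union> (S \<inter> G')) = s + cone_area (S \<inter> G')"
      unfolding s_eq using F(1) G' by (intro cone_area_Un_disjoint) (auto simp: G'_def intro!: sets.finite_UN)
    moreover have "(\<Union>i\<in>F. cball (a i) (r i) \<inter> S) \<union> (S \<inter> G') = S \<inter> G"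
      using F(5) by (auto simp: G'_def)
    ultimately show ?thesis by simp
  qed
  have "hausdorff_content \<delta> k (S \<inter> G) \<le> hausdorff_content \<delta> k ((\<Union>i\<in>F. cball (a i) (r i)) \<union> (S \<inter> G'))"
    by (rule hausdorff_content_mono) (auto simp: G'_def)
  also have "\<dots> \<le> (\<Sum>i\<in>F. hausdorff_gauge k (cball (a i) (r i))) + hausdorff_content \<delta> k (S \<inter> G')"
  proof (rule hausdorff_content_UN_Un_le[OF F(1)])
    show "diameter (cball (a i) (r i)) \<le> \<delta>" if "i \<in> F" for i
      using F(3,4)[OF that] R by simp
  qed simp
  also have "\<dots> \<le> (\<Sum>i\<in>F. ennreal ((1 + \<eta>) * cone_area (cball (a i) (r i) \<inter> S)))
      + ennreal (M * cone_area (S \<inter> G'))"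
  proof (intro add_mono sum_mono M[OF G'])
    fix i assume i: "i \<in> F"
    have "norm (a i) = 1" using F(2)[OF i] by (simp add: S_def)
    from cap[OF this F(3,4)[OF i]]
    show "hausdorff_gauge k (cball (a i) (r i)) \<le> ennreal ((1 + \<eta>) * cone_area (cball (a i) (r i) \<inter> S))"
      using F(3)[OF i] by (simp add: hausdorff_gauge_cball ennreal_leI)
  qed
  also have "\<dots> = ennreal ((1 + \<eta>) * s + M * cone_area (S \<inter> G'))"
    using \<eta> ge by (subst sum_ennreal) (auto simp: s_def sum_distrib_left intro!: ennreal_plus[symmetric] sum_nonneg)
  also have "\<dots> \<le> ennreal ((M - \<theta> * (M - (1 + \<eta>))) * cone_area (S \<inter> G))"
  proof (rule ennreal_leI)
    have "(M - (1 + \<eta>)) * (\<theta> * cone_area (S \<inter> G)) \<le> (M - (1 + \<eta>)) * s"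
      using F(7) ge by (intro mult_left_mono) (auto simp: s_def)
    then show "(1 + \<eta>) * s + M * cone_area (S \<inter> G') \<le> (M - \<theta> * (M - (1 + \<eta>))) * cone_area (S \<inter> G)"
      unfolding split by (simp add: algebra_simps)
  qed
  finally show ?thesis .
qed

text \<open>The improvement of \<open>M\<close> fixes \<open>1 + \<eta>\<close> and multiplies the
  excess over it by \<open>1 - \<theta>\<close>, hence the geometric sequence
  \<open>?M\<close>.\<close>

lemma content_sphere_le: "hausdorff_content \<delta> k S \<le> ennreal ((1 + \<eta>) * cone_area S)"
proof (rule tendsto_lowerbound)
  let ?M = "\<lambda>n. 1 + \<eta> + (1 - \<theta>) ^ n * (5 ^ k * (1 + \<eta>))"
  have P: "hausdorff_content \<delta> k (S \<inter> G) \<le> ennreal (?M n * cone_area (S \<inter> G))" if "open G" for n G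
    using that
  proof (induction n arbitrary: G)
    case 0
    have "5 ^ k * (1 + \<eta>) * cone_area (S \<inter> G) \<le> ?M 0 * cone_area (S \<inter> G)"
      using \<eta> by (intro mult_right_mono) auto
    then show ?case using content_le_initial[OF 0] ennreal_leI order_trans by blast
  next
    case (Suc n)
    have "1 + \<eta> \<le> ?M n" using \<theta> \<eta> by simp
    from content_le_improve[OF Suc.IH this Suc.prems] show ?case
      by (simp add: algebra_simps)
  qed
  have "(\<lambda>n. ?M n * cone_area S) \<longlonglongrightarrow> (1 + \<eta> + 0 * (5 ^ k * (1 + \<eta>))) * cone_area S"
    using \<theta> by (intro tendsto_intros LIMSEQ_power_zero) auto
  then show "(\<lambda>n. ennreal (?M n * cone_area S)) \<longlonglongrightarrow> ennreal ((1 + \<eta>) * cone_area S)"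
    by (intro tendsto_ennrealI) simp
  show "\<forall>\<^sub>F n in sequentially. hausdorff_content \<delta> k S \<le> ennreal (?M n * cone_area S)"
    using P[of UNIV] by simp
qed simp

end

lemma hausdorff_content_sphere_le:
  assumes \<delta>: "0 < \<delta>" "\<delta> < 1" and \<eta>: "0 < \<eta>"
  shows "hausdorff_content \<delta> (CARD('n) - 1) (sphere (0::real^'n) 1)
    \<le> ennreal ((1 + \<eta>) * cone_area (sphere (0::real^'n) 1))"
proof -
  have "((\<lambda>r::real. (1 + \<eta>) * (1 - r\<^sup>2 / 2) ^ CARD('n)) \<longlongrightarrow> (1 + \<eta>) * (1 - 0\<^sup>2 / 2) ^ CARD('n)) (at_right 0)"
    by (intro tendsto_intros) simp
  then have "\<forall>\<^sub>F r in at_right (0::real). 1 < (1 + \<eta>) * (1 - r\<^sup>2 / 2) ^ CARD('n)"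
    by (rule order_tendstoD) (use \<eta> in simp)
  then obtain r0 where r0: "0 < r0" "\<And>r. 0 < r \<Longrightarrow> r < r0 \<Longrightarrow> 1 < (1 + \<eta>) * (1 - r\<^sup>2 / 2) ^ CARD('n)"
    unfolding eventually_at_right_field by auto
  define R where "R = min (r0 / 2) (\<delta> / 10)"
  have R: "0 < R" "R < r0" "10 * R \<le> \<delta>" "R \<le> 1" using r0 \<delta> by (auto simp: R_def)
  interpret cap_estimate \<delta> \<eta> R "sphere (0::real^'n) 1" "CARD('n) - 1"
  proof
    fix u :: "real^'n" and r assume u: "norm u = 1" and r: "0 < r" "r \<le> R"
    let ?c = "unit_ball_vol (real (CARD('n) - 1)) * r ^ (CARD('n) - 1)"
    have "?c * 1 \<le> ?c * ((1 + \<eta>) * (1 - r\<^sup>2 / 2) ^ CARD('n))"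
      using r0(2)[of r] r R by (intro mult_left_mono) auto
    also have "\<dots> = (1 + \<eta>) * (?c * (1 - r\<^sup>2 / 2) ^ CARD('n))" by simp
    also have "\<dots> \<le> (1 + \<eta>) * cone_area (cball u r \<inter> sphere 0 1)"
      using u r R \<eta> by (intro mult_left_mono cone_area_cap_ge) auto
    finally show "?c \<le> (1 + \<eta>) * cone_area (cball u r \<inter> sphere 0 1)" by simp
  qed (use \<delta> \<eta> R in auto)
  show ?thesis by (rule content_sphere_le)
qed

theorem hausdorff_measure_sphere:
  "hausdorff_measure (CARD('n) - 1) (sphere (0::real^'n) 1) = ennreal (CARD('n) * unit_ball_vol CARD('n))"
proof -
  let ?k = "CARD('n) - 1" and ?S = "sphere (0::real^'n) 1"
  have "hausdorff_measure ?k ?S \<le> ennreal (cone_area ?S)"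
    unfolding hausdorff_measure_def
  proof (rule SUP_least)
    fix \<delta> :: real assume \<delta>: "\<delta> \<in> {0<..}"
    \<comment> \<open>Contents increase as \<delta> shrinks, so a bound for a scale below 1 also
      serves larger scales.\<close>
    define \<delta>' where "\<delta>' = min \<delta> (1/2)"
    have "hausdorff_content \<delta>' ?k ?S \<le> ennreal (cone_area ?S)"
    proof (rule tendsto_lowerbound)
      have "((\<lambda>\<eta>. (1 + \<eta>) * cone_area ?S) \<longlongrightarrow> (1 + 0) * cone_area ?S) (at_right 0)"
        by (intro tendsto_intros)
      then show "((\<lambda>\<eta>. ennreal ((1 + \<eta>) * cone_area ?S)) \<longlongrightarrow> ennreal (cone_area ?S)) (at_right 0)"
        by (intro tendsto_ennrealI) simp
      have "\<forall>\<^sub>F \<eta> in at_right (0::real). 0 < \<eta>" by (rule eventually_at_right_less)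
      then show "\<forall>\<^sub>F \<eta> in at_right 0. hausdorff_content \<delta>' ?k ?S \<le> ennreal ((1 + \<eta>) * cone_area ?S)"
      proof eventually_elim
        case (elim \<eta>)
        then show ?case using \<delta> by (intro hausdorff_content_sphere_le) (auto simp: \<delta>'_def)
      qed
    qed simp
    then show "hausdorff_content \<delta> ?k ?S \<le> ennreal (cone_area ?S)"
      using hausdorff_content_antimono[of \<delta>' \<delta> ?k ?S] by (simp add: \<delta>'_def)
  qed
  with cone_area_sphere_le_hausdorff[where 'n = 'n] have "hausdorff_measure ?k ?S = ennreal (cone_area ?S)"
    by (rule antisym[rotated])
  then show ?thesis by (simp add: cone_area_sphere)
qed

lemma sphere_area_eq: "sphere_area TYPE('n::finite) = CARD('n) * unit_ball_vol CARD('n)"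
  unfolding sphere_area_def hausdorff_measure_sphere by simp

section \<open>Asymptotics of the prefactor and of exponential moments\<close>

text \<open>Secant slopes of the convex function ln Gamma increase. The one over [x + 1, x + 1 + s]
  lies between those over the unit intervals [x, x + 1] and [x + 1 + s, x + 2 + s], which the
  functional equation evaluates to ln x and ln (x + 1 + s).\<close>

lemma ln_Gamma_shift_bounds:
  fixes x s :: real
  assumes "0 < x" "0 < s"
  shows "s * ln x \<le> ln (Gamma (x + 1 + s)) - ln (Gamma (x + 1))"
    and "ln (Gamma (x + 1 + s)) - ln (Gamma (x + 1)) \<le> s * ln (x + 1 + s)"
proof -
  define g where "g = ln \<circ> (Gamma :: real \<Rightarrow> real)"
  have g: "convex_on {0<..} g" unfolding g_def by (rule log_convex_Gamma_real)
  have step: "g (y + 1) - g y = ln y" if "y > 0" for y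
  proof -
    have "Gamma (y + 1) = y * Gamma y"
      using that by (intro Gamma_plus1) (auto elim!: nonpos_Ints_cases)
    then show ?thesis using that by (simp add: g_def ln_mult_pos)
  qed
  let ?y = "x + 1" and ?z = "x + 1 + s"
  have 1: "(g x - g ?y) / (x - ?y) \<le> (g x - g ?z) / (x - ?z)"
    and 2: "(g x - g ?z) / (x - ?z) \<le> (g ?y - g ?z) / (?y - ?z)"
    using convex_on_slope_le[OF g, of x ?z ?y] assms by auto
  have "ln x \<le> (g ?z - g ?y) / s"
    using order_trans[OF 1 2] step[of x] assms by (simp add: field_simps)
  then show "s * ln x \<le> ln (Gamma (x + 1 + s)) - ln (Gamma (x + 1))"
    using assms by (simp add: g_def field_simps)
  have 3: "(g ?y - g ?z) / (?y - ?z) \<le> (g ?y - g (?z + 1)) / (?y - (?z + 1))"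
    and 4: "(g ?y - g (?z + 1)) / (?y - (?z + 1)) \<le> (g ?z - g (?z + 1)) / (?z - (?z + 1))"
    using convex_on_slope_le[OF g, of ?y "?z + 1" ?z] assms by auto
  have "(g ?z - g ?y) / s \<le> ln ?z"
    using order_trans[OF 3 4] step[of ?z] assms by (simp add: field_simps)
  then show "ln (Gamma (x + 1 + s)) - ln (Gamma (x + 1)) \<le> s * ln (x + 1 + s)"
    using assms by (simp add: g_def field_simps)
qed

lemma ln_Gamma_shift_asymptotics:
  fixes s :: real
  assumes "0 < s"
  shows "((\<lambda>x. ln (Gamma (x + 1 + s)) - ln (Gamma (x + 1)) - s * ln x) \<longlongrightarrow> 0) at_top"
proof (rule tendsto_sandwich)
  show "\<forall>\<^sub>F x in at_top. 0 \<le> ln (Gamma (x + 1 + s)) - ln (Gamma (x + 1)) - s * ln x"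
    using eventually_gt_at_top[of 0] by eventually_elim (use ln_Gamma_shift_bounds(1) assms in force)
  show "\<forall>\<^sub>F x in at_top. ln (Gamma (x + 1 + s)) - ln (Gamma (x + 1)) - s * ln x
      \<le> s * ln (x + 1 + s) - s * ln x"
    using eventually_gt_at_top[of 0] by eventually_elim (use ln_Gamma_shift_bounds(2) assms in force)
  show "((\<lambda>x. s * ln (x + 1 + s) - s * ln x) \<longlongrightarrow> 0) at_top"
    using assms by real_asymp
qed simp

text \<open>For p = 1 + h the first beta argument p / (p - 1) is 1 / h + 1, and the ratio of Gamma
  values in Beta behaves like h to the power s.\<close>

lemma ln_Beta_asymptotics:
  fixes s :: real
  assumes s: "0 < s"
  shows "((\<lambda>h. ln (Beta (1 / h + 1) s) - s * ln h) \<longlongrightarrow> ln (Gamma s)) (at_right 0)"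
proof -
  have "filterlim (\<lambda>h::real. 1 / h) at_top (at_right 0)" by real_asymp
  from filterlim_compose[OF ln_Gamma_shift_asymptotics[OF s] this]
  have "((\<lambda>h. ln (Gamma s) - (ln (Gamma (1 / h + 1 + s)) - ln (Gamma (1 / h + 1)) - s * ln (1 / h)))
      \<longlongrightarrow> ln (Gamma s) - 0) (at_right 0)"
    by (intro tendsto_intros)
  moreover have "\<forall>\<^sub>F h in at_right (0::real).
      ln (Gamma s) - (ln (Gamma (1 / h + 1 + s)) - ln (Gamma (1 / h + 1)) - s * ln (1 / h))
      = ln (Beta (1 / h + 1) s) - s * ln h"
    using eventually_at_right_less[of 0]
  proof eventually_elim
    case (elim h)
    have "0 < 1 / h" using elim by simp
    then have "0 < 1 / h + 1" "0 < 1 / h + 1 + s" using s by linarith+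
    then have "Gamma (1 / h + 1) > 0" "Gamma (1 / h + 1 + s) > 0" "Gamma s > 0"
      using s Gamma_real_pos by blast+
    then have "ln (Beta (1 / h + 1) s) = ln (Gamma (1 / h + 1)) + ln (Gamma s) - ln (Gamma (1 / h + 1 + s))"
      unfolding Beta_def by (simp add: ln_div ln_mult)
    then show ?case using elim by (simp add: ln_div)
  qed
  ultimately show ?thesis by (simp add: tendsto_cong)
qed

text \<open>The hypothesis on \<open>\<kappa>\<close> reads \<open>K = 1 + h \<kappa>\<close>, so that the divergent part \<open>\<epsilon> / h\<close> cancels.\<close>

lemma tendsto_renormalized_product:
  fixes A K w \<kappa> :: "real \<Rightarrow> real"
  assumes w: "(w \<longlongrightarrow> w0) (at_right 0)" and \<kappa>: "(\<kappa> \<longlongrightarrow> \<kappa>0) (at_right 0)"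
    and A: "\<forall>\<^sub>F h in at_right 0. A h = \<epsilon> / h * exp (h * w h)"
    and K: "\<forall>\<^sub>F h in at_right 0. K h = 1 + h * \<kappa> h"
  shows "((\<lambda>h. A h * K h - \<epsilon> / h) \<longlongrightarrow> \<epsilon> * (w0 + \<kappa>0)) (at_right 0)"
proof -
  \<comment> \<open>The continuous extension of the difference quotient of exp is used because h * w
    h may vanish.\<close>
  define E where "E y = (if y = 0 then 1 else (exp y - 1) / y)" for y :: real
  have "((\<lambda>y::real. (exp (0 + y) - exp 0) / y) \<longlongrightarrow> exp 0) (at 0)"
    using DERIV_exp[of 0] unfolding DERIV_def .
  then have "(E \<longlongrightarrow> exp 0) (at 0)"
    by (rule Lim_transform_eventually) (auto simp: E_def eventually_at_filter)
  then have E: "isCont E 0" by (simp add: isCont_def E_def)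
  have h0: "((\<lambda>h::real. h) \<longlongrightarrow> 0) (at_right 0)" by (rule tendsto_ident_at)
  have hw: "((\<lambda>h. h * w h) \<longlongrightarrow> 0) (at_right 0)"
    using tendsto_mult[OF h0 w] by simp
  have "((\<lambda>h. \<epsilon> * (w h * E (h * w h) + exp (h * w h) * \<kappa> h)) \<longlongrightarrow> \<epsilon> * (w0 * E 0 + exp 0 * \<kappa>0)) (at_right 0)"
    by (intro tendsto_intros w \<kappa> hw isCont_tendsto_compose[OF E hw])
  moreover have "\<forall>\<^sub>F h in at_right 0. \<epsilon> * (w h * E (h * w h) + exp (h * w h) * \<kappa> h) = A h * K h - \<epsilon> / h"
    using A K eventually_at_right_less[of 0]
  proof eventually_elim
    case (elim h)
    have "h * (w h * E (h * w h)) = exp (h * w h) - 1"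
      by (auto simp: E_def)
    then have "h * (w h * E (h * w h) + exp (h * w h) * \<kappa> h) = exp (h * w h) * (1 + h * \<kappa> h) - 1"
      by (simp add: algebra_simps)
    then have "\<epsilon> / h * (h * (w h * E (h * w h) + exp (h * w h) * \<kappa> h))
        = \<epsilon> / h * (exp (h * w h) * (1 + h * \<kappa> h) - 1)"
      by (simp only:)
    moreover have "\<epsilon> / h * (h * (w h * E (h * w h) + exp (h * w h) * \<kappa> h))
        = \<epsilon> * (w h * E (h * w h) + exp (h * w h) * \<kappa> h)"
      using elim by simp
    moreover have "A h * K h - \<epsilon> / h = \<epsilon> / h * (exp (h * w h) * (1 + h * \<kappa> h) - 1)"
      by (simp only: elim right_diff_distrib mult.assoc mult_1_right)
    ultimately show ?case by (simp only:)
  qed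
  ultimately show ?thesis by (simp add: tendsto_cong E_def)
qed

section \<open>Differentiation of an exponential moment\<close>

lemma exp_bound_abs: "\<bar>exp s - 1\<bar> \<le> \<bar>s\<bar> * exp (max s 0)" for s :: real
proof (cases "s \<ge> 0")
  case True
  have "exp s * (1 - s) \<le> exp s * exp (- s)"
    using exp_ge_add_one_self[of "-s"] by (intro mult_left_mono) auto
  then show ?thesis using True by (simp add: exp_minus algebra_simps)
next
  case False
  have "1 - exp s \<le> - s" using exp_ge_add_one_self[of s] by linarith
  then show ?thesis using False by simp
qed

text \<open>Dominated convergence for the difference quotients, restricted to a \<le> a0 / 2. Where
  L is negative, half of the available exponent bounds exp (- a L) and the other half absorbs the
  factor \<bar>L\<bar>, at the price of 2 / a0; where L is nonnegative, \<bar>L\<bar> itself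
  dominates.\<close>

lemma (in prob_space) exponential_moment_derivative:
  fixes L :: "'a \<Rightarrow> real"
  assumes L: "integrable M L" and a0: "0 < a0" and E: "integrable M (\<lambda>x. exp (- a0 * L x))"
  shows "\<And>a. 0 \<le> a \<Longrightarrow> a \<le> a0 \<Longrightarrow> integrable M (\<lambda>x. exp (- a * L x))"
    and "((\<lambda>a. ((\<integral>x. exp (- a * L x) \<partial>M) - 1) / a) \<longlongrightarrow> - (\<integral>x. L x \<partial>M)) (at_right 0)"
proof -
  have [measurable]: "L \<in> borel_measurable M" using L by simp
  show int: "integrable M (\<lambda>x. exp (- a * L x))" if a: "0 \<le> a" "a \<le> a0" for a
  proof (rule Bochner_Integration.integrable_bound)
    show "integrable M (\<lambda>x. 1 + exp (- a0 * L x))" using E by simp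
    have "exp (- a * L x) \<le> 1 + exp (- a0 * L x)" for x
    proof (cases "L x \<ge> 0")
      case True
      then have "exp (- a * L x) \<le> 1" using a by simp
      then show ?thesis by (smt (verit) exp_gt_zero)
    next
      case False
      then have "- a * L x \<le> - a0 * L x" using a by (simp add: mult_right_mono_neg)
      then show ?thesis using exp_le_cancel_iff by (smt (verit))
    qed
    then show "AE x in M. norm (exp (- a * L x)) \<le> norm (1 + exp (- a0 * L x))"
      by (auto simp: abs_of_nonneg add_nonneg_nonneg)
  qed simp
  show "((\<lambda>a. ((\<integral>x. exp (- a * L x) \<partial>M) - 1) / a) \<longlongrightarrow> - (\<integral>x. L x \<partial>M)) (at_right 0)"
    unfolding tendsto_at_iff_sequentially
  proof (intro allI impI)
    fix X :: "nat \<Rightarrow> real"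
    assume X: "\<forall>i. X i \<in> {0<..} - {0}" "X \<longlonglongrightarrow> 0"
    then have pos: "\<And>i. X i > 0" by auto
    have "\<forall>\<^sub>F i in sequentially. X i < a0 / 2"
      using X(2) a0 by (intro order_tendstoD) auto
    then obtain N where N: "\<And>i. i \<ge> N \<Longrightarrow> X i < a0 / 2"
      by (auto simp: eventually_sequentially)
    let ?Y = "\<lambda>i. X (i + N)"
    have Y: "0 < ?Y i" "?Y i \<le> a0 / 2" for i using pos N[of "i + N"] by auto
    have Y0: "?Y \<longlonglongrightarrow> 0" using X(2) by (rule LIMSEQ_ignore_initial_segment)
    have "(\<lambda>i. \<integral>x. (exp (- ?Y i * L x) - 1) / ?Y i \<partial>M) \<longlonglongrightarrow> (\<integral>x. - L x \<partial>M)"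
    proof (rule integral_dominated_convergence[where w = "\<lambda>x. \<bar>L x\<bar> + 2 / a0 * exp (- a0 * L x)"])
      show "integrable M (\<lambda>x. \<bar>L x\<bar> + 2 / a0 * exp (- a0 * L x))" using L E by simp
      show "AE x in M. (\<lambda>i. (exp (- ?Y i * L x) - 1) / ?Y i) \<longlonglongrightarrow> - L x"
      proof (rule AE_I2)
        fix x
        have "((\<lambda>a. exp (- a * L x)) has_real_derivative - L x) (at 0)"
          by (auto intro!: derivative_eq_intros)
        then have "((\<lambda>a. (exp (- a * L x) - 1) / a) \<longlongrightarrow> - L x) (at 0)"
          by (simp add: DERIV_def)
        moreover have "filterlim ?Y (at 0) sequentially"
          using Y Y0 by (auto simp: filterlim_at less_imp_neq[symmetric])
        ultimately show "(\<lambda>i. (exp (- ?Y i * L x) - 1) / ?Y i) \<longlonglongrightarrow> - L x"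
          by (rule filterlim_compose)
      qed
      show "AE x in M. norm ((exp (- ?Y i * L x) - 1) / ?Y i) \<le> \<bar>L x\<bar> + 2 / a0 * exp (- a0 * L x)" for i
      proof (rule AE_I2)
        fix x
        define a where "a = ?Y i"
        have a: "0 < a" "a \<le> a0 / 2" using Y by (auto simp: a_def)
        have "\<bar>exp (- a * L x) - 1\<bar> / a \<le> (\<bar>- a * L x\<bar> * exp (max (- a * L x) 0)) / a"
          using exp_bound_abs[of "- a * L x"] a by (intro divide_right_mono) auto
        also have "\<dots> = \<bar>L x\<bar> * exp (max (- a * L x) 0)" using a by (simp add: abs_mult)
        also have "\<dots> \<le> \<bar>L x\<bar> + 2 / a0 * exp (- a0 * L x)"
        proof (cases "L x \<ge> 0")
          case True
          then have "max (- a * L x) 0 = 0" using a by simp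
          then show ?thesis using a0 by simp
        next
          case False
          then have "- a * L x \<le> a0 / 2 * \<bar>L x\<bar>"
            using a a0 mult_right_mono[OF a(2), of "\<bar>L x\<bar>"] by auto
          moreover have "0 \<le> a0 / 2 * \<bar>L x\<bar>"
            using a0 by (intro mult_nonneg_nonneg) auto
          ultimately have 1: "exp (max (- a * L x) 0) \<le> exp (a0 / 2 * \<bar>L x\<bar>)" by simp
          have "a0 / 2 * \<bar>L x\<bar> \<le> exp (a0 / 2 * \<bar>L x\<bar>)"
            using exp_ge_add_one_self[of "a0 / 2 * \<bar>L x\<bar>"] by linarith
          then have "\<bar>L x\<bar> \<le> 2 / a0 * exp (a0 / 2 * \<bar>L x\<bar>)" using a0 by (simp add: field_simps)
          then have "\<bar>L x\<bar> * exp (max (- a * L x) 0)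
              \<le> (2 / a0 * exp (a0 / 2 * \<bar>L x\<bar>)) * exp (a0 / 2 * \<bar>L x\<bar>)"
            using 1 a0 by (intro mult_mono) auto
          also have "\<dots> = 2 / a0 * exp (- a0 * L x)"
            using False by (simp add: exp_add[symmetric])
          finally show ?thesis by simp
        qed
        finally show "norm ((exp (- ?Y i * L x) - 1) / ?Y i) \<le> \<bar>L x\<bar> + 2 / a0 * exp (- a0 * L x)"
          using a by (simp add: a_def abs_divide)
      qed
    qed auto
    also have "(\<lambda>i. \<integral>x. (exp (- ?Y i * L x) - 1) / ?Y i \<partial>M)
        = (\<lambda>i. ((\<integral>x. exp (- ?Y i * L x) \<partial>M) - 1) / ?Y i)"
    proof
      fix i
      have "integrable M (\<lambda>x. exp (- ?Y i * L x))" using Y[of i] a0 by (intro int) auto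
      then show "(\<integral>x. (exp (- ?Y i * L x) - 1) / ?Y i \<partial>M) = ((\<integral>x. exp (- ?Y i * L x) \<partial>M) - 1) / ?Y i"
        by (simp add: prob_space)
    qed
    finally have "(\<lambda>i. ((\<integral>x. exp (- ?Y i * L x) \<partial>M) - 1) / ?Y i) \<longlonglongrightarrow> - (\<integral>x. L x \<partial>M)"
      by simp
    then show "((\<lambda>a. ((\<integral>x. exp (- a * L x) \<partial>M) - 1) / a) \<circ> X) \<longlonglongrightarrow> - (\<integral>x. L x \<partial>M)"
      unfolding comp_def by (rule LIMSEQ_offset)
  qed
qed

section \<open>Integrability of small negative powers of a density\<close>

lemma nn_integral_inverse_one_plus_square_finite:
  "(\<integral>\<^sup>+t. ennreal (inverse (1 + t\<^sup>2)) \<partial>lborel) < (\<infinity> :: ennreal)"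
proof -
  have half: "(\<integral>\<^sup>+t. ennreal (inverse (1 + t\<^sup>2)) * indicator {0..} t \<partial>lborel) = ennreal (pi / 2 - arctan 0)"
    by (rule nn_integral_FTC_atLeast)
       (auto intro!: derivative_eq_intros tendsto_arctan_at_top simp: add_nonneg_nonneg)
  have "(\<integral>\<^sup>+t. ennreal (inverse (1 + t\<^sup>2)) * indicator {..0} t \<partial>lborel)
      = (\<integral>\<^sup>+t. ennreal (inverse (1 + t\<^sup>2)) * indicator {0..} t \<partial>distr lborel borel uminus)"
    by (subst nn_integral_distr) (auto simp: indicator_def intro!: nn_integral_cong)
  then have half': "(\<integral>\<^sup>+t. ennreal (inverse (1 + t\<^sup>2)) * indicator {..0} t \<partial>lborel) = ennreal (pi / 2 - arctan 0)"
    using half by (simp add: lborel_distr_uminus)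
  have "(\<integral>\<^sup>+t. ennreal (inverse (1 + t\<^sup>2)) \<partial>lborel)
      \<le> (\<integral>\<^sup>+t. ennreal (inverse (1 + t\<^sup>2)) * indicator {0..} t
            + ennreal (inverse (1 + t\<^sup>2)) * indicator {..0} t \<partial>lborel)"
    by (intro nn_integral_mono) (auto simp: indicator_def)
  also have "\<dots> = ennreal (pi / 2 - arctan 0) + ennreal (pi / 2 - arctan 0)"
    by (subst nn_integral_add) (simp_all only: half half', measurable)
  also have "\<dots> < \<infinity>" by simp
  finally show ?thesis .
qed

text \<open>Each factor \<open>1 + (norm x)\<^sup>2\<close> dominates one coordinate factor, so the
  integral is bounded by a product of one-dimensional arctangent integrals.\<close>

lemma nn_integral_inverse_power_finite:
  "(\<integral>\<^sup>+x. ennreal (inverse ((1 + (norm x)\<^sup>2) ^ DIM('a))) \<partial>(lborel :: 'a::euclidean_space measure)) < \<infinity>"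
proof -
  have "(\<integral>\<^sup>+x. ennreal (inverse ((1 + (norm x)\<^sup>2) ^ DIM('a))) \<partial>(lborel :: 'a measure))
      \<le> (\<integral>\<^sup>+x. (\<Prod>b\<in>Basis. ennreal (inverse (1 + (x \<bullet> b)\<^sup>2))) \<partial>(lborel :: 'a measure))"
  proof (rule nn_integral_mono)
    fix x :: 'a
    have "(\<Prod>b\<in>Basis. 1 + (x \<bullet> b)\<^sup>2) \<le> (\<Prod>b\<in>(Basis :: 'a set). 1 + (norm x)\<^sup>2)"
    proof (intro prod_mono conjI)
      fix b :: 'a assume "b \<in> Basis"
      then have "\<bar>x \<bullet> b\<bar> \<le> norm x" by (rule Basis_le_norm)
      then have "(x \<bullet> b)\<^sup>2 \<le> (norm x)\<^sup>2" by (simp add: abs_le_square_iff[symmetric])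
      then show "1 + (x \<bullet> b)\<^sup>2 \<le> 1 + (norm x)\<^sup>2" by simp
    qed (simp add: add_nonneg_nonneg)
    then have "inverse ((1 + (norm x)\<^sup>2) ^ DIM('a)) \<le> inverse (\<Prod>b\<in>Basis. 1 + (x \<bullet> b)\<^sup>2)"
      by (intro le_imp_inverse_le prod_pos) (auto intro: add_pos_nonneg)
    also have "\<dots> = (\<Prod>b\<in>Basis. inverse (1 + (x \<bullet> b)\<^sup>2))" 
      using prod_inversef[of "\<lambda>b. 1 + (x \<bullet> b)\<^sup>2" Basis] by (simp add: comp_def)
    finally show "ennreal (inverse ((1 + (norm x)\<^sup>2) ^ DIM('a)))
        \<le> (\<Prod>b\<in>Basis. ennreal (inverse (1 + (x \<bullet> b)\<^sup>2)))"
      by (subst prod_ennreal) (auto intro!: ennreal_leI add_nonneg_nonneg)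
  qed
  also have "\<dots> = (\<Prod>b\<in>(Basis :: 'a set). (\<integral>\<^sup>+t. ennreal (inverse (1 + t\<^sup>2)) \<partial>lborel))"
    by (rule nn_integral_lborel_prod) auto
  also have "\<dots> < \<infinity>"
    using nn_integral_inverse_one_plus_square_finite by (simp add: power_less_top_ennreal)
  finally show ?thesis .
qed

text \<open>The two terms are the two sides of the threshold f = \<open>w powr (- (d + 1))\<close>:
  below it monotonicity in f gives \<open>w powr (- d)\<close>, above it
  \<open>f powr (- (1 / (d + 1)))\<close> is at most w.\<close>

lemma powr_le_weighted:
  fixes f w d :: real
  assumes "0 < f" "0 < w" "0 < d"
  shows "f powr (d / (d + 1)) \<le> f * w + w powr (- d)"
proof (cases "f \<le> w powr (- (d + 1))")
  case True
  then have "f powr (d / (d + 1)) \<le> (w powr (- (d + 1))) powr (d / (d + 1))"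
    using assms by (intro powr_mono2) auto
  also have "\<dots> = w powr (- d)"
  proof -
    have "- (d + 1) * (d / (d + 1)) = - d" using assms by (simp add: field_simps)
    then show ?thesis by (simp only: powr_powr)
  qed
  finally show ?thesis using assms by (simp add: add_increasing)
next
  case False
  have "f powr (d / (d + 1)) = f * f powr (- (1 / (d + 1)))"
  proof -
    have "d / (d + 1) = 1 + - (1 / (d + 1))" using assms by (simp add: field_simps)
    then show ?thesis using assms by (simp only: powr_add) simp
  qed
  also have "f powr (- (1 / (d + 1))) \<le> (w powr (- (d + 1))) powr (- (1 / (d + 1)))"
    using False assms by (intro powr_mono2') auto
  also have "\<dots> = w"
  proof -
    have "- (d + 1) * (- (1 / (d + 1))) = 1" using assms by (simp add: field_simps)
    then show ?thesis using assms by (simp only: powr_powr powr_one)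
  qed
  finally have "f powr (d / (d + 1)) \<le> f * w" using assms by simp
  then show ?thesis by (simp add: add_increasing2)
qed

section \<open>The transport cost\<close>

lemma lebesgue_density_borel [measurable]: "lebesgue_density \<mu> \<in> borel_measurable borel"
proof -
  have "RN_deriv lborel \<mu> \<in> borel_measurable borel"
    using borel_measurable_RN_deriv[of lborel \<mu>] by simp
  then show ?thesis unfolding lebesgue_density_def by measurable
qed

lemma density_lebesgue_density:
  fixes \<mu> :: "(real^'n) measure"
  assumes "prob_space \<mu>" "sets \<mu> = sets borel" "absolutely_continuous lborel \<mu>"
  shows "density lborel (\<lambda>x. ennreal (lebesgue_density \<mu> x)) = \<mu>"
proof -
  interpret prob_space \<mu> by fact
  have "AE x in lborel. RN_deriv lborel \<mu> x \<noteq> \<infinity>"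
    using assms
    by (intro sigma_finite_measure.RN_deriv_finite[OF lborel.sigma_finite_measure_axioms]
        sigma_finite_measure_axioms) auto
  then have "AE x in lborel. ennreal (lebesgue_density \<mu> x) = RN_deriv lborel \<mu> x"
    by eventually_elim (simp add: lebesgue_density_def top.not_eq_extremum)
  then have "density lborel (\<lambda>x. ennreal (lebesgue_density \<mu> x)) = density lborel (RN_deriv lborel \<mu>)"
    by (intro density_cong) auto
  also have "\<dots> = \<mu>" using assms by (intro sigma_finite_measure.density_RN_deriv[OF lborel.sigma_finite_measure_axioms]) auto
  finally show ?thesis .
qed

lemma AE_lebesgue_density_pos:
  fixes \<mu> :: "(real^'n) measure"
  assumes "prob_space \<mu>" "sets \<mu> = sets borel" "absolutely_continuous lborel \<mu>"
  shows "AE x in \<mu>. lebesgue_density \<mu> x > 0"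
  by (subst density_lebesgue_density[OF assms, symmetric], subst AE_density) auto

text \<open>The exponent \<open>1 / (d + 1)\<close> is small enough for the second moment to control the tail:
  compare \<open>f powr (1 - 1 / (d + 1))\<close> with the weight \<open>1 + |x|\<^sup>2\<close>.\<close>

lemma nn_integral_density_powr_finite:
  fixes \<mu> :: "(real^'n) measure"
  assumes mom: "\<mu> \<in> prob_moment_ac 2"
  shows "(\<integral>\<^sup>+x. ennreal (lebesgue_density \<mu> x powr (- (1 / (CARD('n) + 1)))) \<partial>\<mu>) < \<infinity>"
proof -
  let ?d = "real CARD('n)"
  let ?f = "lebesgue_density \<mu>"
  let ?w = "\<lambda>x::real^'n. 1 + (norm x)\<^sup>2"
  have \<mu>: "prob_space \<mu>" "sets \<mu> = sets borel" "absolutely_continuous lborel \<mu>"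
    "(\<integral>\<^sup>+ x. ennreal (norm x powr 2) \<partial>\<mu>) < \<infinity>"
    using mom by (auto simp: prob_moment_ac_def prob_moment_def)
  note [measurable_cong] = \<mu>(2)
  interpret prob_space \<mu> by fact
  note dens = density_lebesgue_density[OF \<mu>(1-3)]
  have int: "(\<integral>\<^sup>+x. g x \<partial>\<mu>) = (\<integral>\<^sup>+x. ennreal (?f x) * g x \<partial>lborel)"
    if "g \<in> borel_measurable borel" for g
    using that by (subst dens[symmetric], subst nn_integral_density) auto
  have "(\<integral>\<^sup>+x. ennreal (?f x powr (- (1 / (CARD('n) + 1)))) \<partial>\<mu>)
      = (\<integral>\<^sup>+x. ennreal (?f x) * ennreal (?f x powr (- (1 / (CARD('n) + 1)))) \<partial>lborel)"
    by (rule int) measurable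
  also have "\<dots> \<le> (\<integral>\<^sup>+x. ennreal (?f x) * ennreal (?w x) + ennreal (inverse (?w x ^ CARD('n))) \<partial>lborel)"
  proof (rule nn_integral_mono)
    fix x :: "real^'n"
    have f0: "0 \<le> ?f x" by (simp add: lebesgue_density_def)
    have w: "0 < ?w x" by (intro add_pos_nonneg) auto
    show "ennreal (?f x) * ennreal (?f x powr (- (1 / (CARD('n) + 1))))
      \<le> ennreal (?f x) * ennreal (?w x) + ennreal (inverse (?w x ^ CARD('n)))"
    proof (cases "?f x = 0")
      case False
      then have fp: "0 < ?f x" using f0 by simp
      have "?f x * ?f x powr (- (1 / (?d + 1))) = ?f x powr (?d / (?d + 1))"
      proof -
        have "?d / (?d + 1) = 1 + - (1 / (?d + 1))" by (simp add: field_simps)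
        then show ?thesis using fp by (simp only: powr_add) simp
      qed
      also have "\<dots> \<le> ?f x * ?w x + ?w x powr (- ?d)"
        using fp w by (intro powr_le_weighted) auto
      also have "?w x powr (- ?d) = inverse (?w x ^ CARD('n))"
        using w by (simp add: powr_minus powr_realpow)
      finally have "ennreal (?f x * ?f x powr (- (1 / (?d + 1))))
          \<le> ennreal (?f x * ?w x + inverse (?w x ^ CARD('n)))"
        by (rule ennreal_leI)
      then show ?thesis
        using f0 w by (simp add: ennreal_mult ennreal_plus add.commute)
    qed simp
  qed
  also have "\<dots> = (\<integral>\<^sup>+x. ennreal (?w x) \<partial>\<mu>) + (\<integral>\<^sup>+x. ennreal (inverse (?w x ^ CARD('n))) \<partial>lborel)"
    by (subst nn_integral_add) (auto simp: int)
  also have "\<dots> < \<infinity>"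
  proof -
    have "(\<integral>\<^sup>+x. ennreal (?w x) \<partial>\<mu>) = (\<integral>\<^sup>+x. 1 + ennreal (norm x powr 2) \<partial>\<mu>)"
      by (intro nn_integral_cong, subst ennreal_plus) (auto simp: powr_numeral)
    also have "\<dots> = 1 + (\<integral>\<^sup>+x. ennreal (norm x powr 2) \<partial>\<mu>)"
      by (subst nn_integral_add) (auto simp: emeasure_space_1)
    also have "\<dots> < \<infinity>" using \<mu>(4) by simp
    finally show ?thesis
      using nn_integral_inverse_power_finite[where 'a = "real^'n"] by simp
  qed
  finally show ?thesis .
qed

text \<open>The product of powers is split into a sum by p * q \<le> p * p + q * q, so that each
  density can be integrated against its own measure. The price is a doubled exponent.\<close>

lemma exp_ln_mult_le:
  fixes u v a :: real
  assumes "0 < u" "0 < v"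
  shows "exp (- a * ln (u * v)) \<le> u powr (- (2 * a)) + v powr (- (2 * a))"
proof -
  let ?p = "u powr (- a)" and ?q = "v powr (- a)"
  have "exp (- a * ln (u * v)) = ?p * ?q"
    using assms by (simp add: powr_def ln_mult_pos exp_add[symmetric] algebra_simps)
  also have "\<dots> \<le> ?p\<^sup>2 + ?q\<^sup>2"
  proof -
    have "0 \<le> (?p - ?q)\<^sup>2 + (?p\<^sup>2 + ?q\<^sup>2)" by simp
    then show ?thesis by (simp add: power2_diff)
  qed
  also have "?p\<^sup>2 + ?q\<^sup>2 = u powr (- (2 * a)) + v powr (- (2 * a))"
    using assms by (simp add: power2_eq_square powr_add[symmetric])
  finally show ?thesis .
qed

locale transport_pair =
  fixes \<mu> \<nu> :: "(real^'n) measure" and T :: "real^'n \<Rightarrow> real^'n" and L :: "real^'n \<Rightarrow> real"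
  assumes \<mu>: "\<mu> \<in> prob_moment_ac 2" and \<nu>: "\<nu> \<in> prob_moment_ac 2"
    and T [measurable]: "T \<in> borel_measurable borel" and push: "distr \<mu> borel T = \<nu>"
    and log_finite: "(\<integral>\<^sup>+ x. ennreal \<bar>ln (lebesgue_density \<mu> x)\<bar> \<partial>\<mu>)
       + (\<integral>\<^sup>+ x. ennreal \<bar>ln (lebesgue_density \<nu> x)\<bar> \<partial>\<nu>) < \<infinity>"
  defines "L \<equiv> \<lambda>x. ln (lebesgue_density \<mu> x * lebesgue_density \<nu> (T x))"
begin

lemma mu: "prob_space \<mu>" "sets \<mu> = sets borel" "absolutely_continuous lborel \<mu>"
  and nu: "prob_space \<nu>" "sets \<nu> = sets borel" "absolutely_continuous lborel \<nu>"
  using \<mu> \<nu> by (auto simp: prob_moment_ac_def prob_moment_def)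

lemma sets_mu [measurable_cong]: "sets \<mu> = sets borel"
  by (fact mu)

sublocale prob_space \<mu>
  by (fact mu)

lemma nn_integral_push:
  assumes [measurable]: "g \<in> borel_measurable borel"
  shows "(\<integral>\<^sup>+x. g (T x) \<partial>\<mu>) = (\<integral>\<^sup>+x. g x \<partial>\<nu>)"
  unfolding push[symmetric] by (subst nn_integral_distr) auto

lemma AE_pos: "AE x in \<mu>. lebesgue_density \<mu> x > 0 \<and> lebesgue_density \<nu> (T x) > 0"
proof -
  have "AE x in distr \<mu> borel T. lebesgue_density \<nu> x > 0"
    unfolding push by (rule AE_lebesgue_density_pos[OF nu])
  then have "AE x in \<mu>. lebesgue_density \<nu> (T x) > 0"
    by (subst (asm) AE_distr_iff) auto
  with AE_lebesgue_density_pos[OF mu] show ?thesis by (rule AE_conjI)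
qed

lemma L_borel [measurable]: "L \<in> borel_measurable borel"
  unfolding L_def by measurable

text \<open>Positivity almost everywhere splits the logarithm, and the second part is transported to
  \<nu>. Without integrability the Bochner integral in \<open>K_EOT\<close> would be the default
  value 0.\<close>

lemma integrable_L: "integrable \<mu> L"
proof (rule integrableI_bounded)
  have "(\<integral>\<^sup>+x. ennreal (norm (L x)) \<partial>\<mu>)
      \<le> (\<integral>\<^sup>+x. ennreal \<bar>ln (lebesgue_density \<mu> x)\<bar> + ennreal \<bar>ln (lebesgue_density \<nu> (T x))\<bar> \<partial>\<mu>)"
    using AE_pos
    by (intro nn_integral_mono_AE, elim eventually_mono)
       (auto simp: L_def ln_mult_pos ennreal_plus[symmetric] simp del: ennreal_plus intro!: ennreal_leI)
  also have "\<dots> = (\<integral>\<^sup>+x. ennreal \<bar>ln (lebesgue_density \<mu> x)\<bar> \<partial>\<mu>)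
      + (\<integral>\<^sup>+x. ennreal \<bar>ln (lebesgue_density \<nu> x)\<bar> \<partial>\<nu>)"
    using nn_integral_push[of "\<lambda>x. ennreal \<bar>ln (lebesgue_density \<nu> x)\<bar>"] by (subst nn_integral_add) auto
  also have "\<dots> < \<infinity>" by (fact log_finite)
  finally show "(\<integral>\<^sup>+x. ennreal (norm (L x)) \<partial>\<mu>) < \<infinity>" .
qed measurable

text \<open>Half of 1 / (d + 1), because \<open>exp_ln_mult_le\<close> doubles the exponent.\<close>

definition a0 :: real where "a0 = 1 / (2 * (CARD('n) + 1))"

lemma integrable_exp_L: "integrable \<mu> (\<lambda>x. exp (- a0 * L x))"
proof (rule integrableI_bounded)
  let ?g = "\<lambda>\<rho> x. ennreal (lebesgue_density \<rho> x powr (- (1 / (CARD('n) + 1))))"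
  have "2 * a0 = 1 / (CARD('n) + 1)" by (simp add: a0_def field_simps)
  then have "(\<integral>\<^sup>+x. ennreal (norm (exp (- a0 * L x))) \<partial>\<mu>) \<le> (\<integral>\<^sup>+x. ?g \<mu> x + ?g \<nu> (T x) \<partial>\<mu>)"
    using AE_pos exp_ln_mult_le[where a = a0]
    by (intro nn_integral_mono_AE, elim eventually_mono)
       (auto simp: L_def ennreal_plus[symmetric] simp del: ennreal_plus intro!: ennreal_leI)
  also have "\<dots> = (\<integral>\<^sup>+x. ?g \<mu> x \<partial>\<mu>) + (\<integral>\<^sup>+x. ?g \<nu> x \<partial>\<nu>)"
    using nn_integral_push[of "?g \<nu>"] by (subst nn_integral_add) auto
  also have "\<dots> < \<infinity>"
    using nn_integral_density_powr_finite[OF \<mu>] nn_integral_density_powr_finite[OF \<nu>] by simp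
  finally show "(\<integral>\<^sup>+x. ennreal (norm (exp (- a0 * L x))) \<partial>\<mu>) < \<infinity>" .
qed measurable

lemma a0_pos: "0 < a0"
  by (simp add: a0_def)

lemma nn_integral_powr_eq:
  assumes "0 \<le> a" "a \<le> a0"
  shows "(\<integral>\<^sup>+x. ennreal ((lebesgue_density \<nu> (T x) * lebesgue_density \<mu> x) powr (- a)) \<partial>\<mu>)
    = ennreal (\<integral>x. exp (- a * L x) \<partial>\<mu>)"
proof -
  have "(\<integral>\<^sup>+x. ennreal ((lebesgue_density \<nu> (T x) * lebesgue_density \<mu> x) powr (- a)) \<partial>\<mu>)
      = (\<integral>\<^sup>+x. ennreal (exp (- a * L x)) \<partial>\<mu>)"
    using AE_pos
    by (intro nn_integral_cong_AE, elim eventually_mono) (auto simp: L_def powr_def mult.commute)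
  also have "\<dots> = ennreal (\<integral>x. exp (- a * L x) \<partial>\<mu>)"
    using exponential_moment_derivative(1)[OF integrable_L a0_pos integrable_exp_L assms]
    by (intro nn_integral_eq_integral) auto
  finally show ?thesis .
qed

definition \<kappa> :: "real \<Rightarrow> real" where
  "\<kappa> h = ((\<integral>x. exp (- (h / (real CARD('n) * h + 2)) * L x) \<partial>\<mu>) - 1) / h"

text \<open>The exponential moment is differentiated in a = h / (d h + 2), whereas
  \<open>\<kappa>\<close> is a quotient in h. The ratio a / h tends to 1 / 2, the factor in
  \<open>K_EOT\<close>.\<close>

lemma \<kappa>_tendsto: "(\<kappa> \<longlongrightarrow> - 1 / 2 * (\<integral>x. L x \<partial>\<mu>)) (at_right 0)"
proof -
  let ?d = "real CARD('n)"
  let ?a = "\<lambda>h. h / (?d * h + 2)"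
  have "((\<lambda>h. h / (?d * h + 2)) \<longlongrightarrow> 0 / (?d * 0 + 2)) (at_right 0)"
    by (intro tendsto_intros) auto
  moreover have "\<forall>\<^sub>F h in at_right 0. ?a h \<in> {0<..}"
    using eventually_at_right_less[of 0] by eventually_elim (auto intro!: divide_pos_pos add_nonneg_pos)
  ultimately have "filterlim ?a (at_right 0) (at_right 0)"
    by (auto simp: filterlim_at elim: eventually_mono)
  from filterlim_compose[OF exponential_moment_derivative(2)[OF integrable_L a0_pos integrable_exp_L] this]
  have "((\<lambda>h. ((\<integral>x. exp (- ?a h * L x) \<partial>\<mu>) - 1) / ?a h) \<longlongrightarrow> - (\<integral>x. L x \<partial>\<mu>)) (at_right 0)" .
  then have "((\<lambda>h. ((\<integral>x. exp (- ?a h * L x) \<partial>\<mu>) - 1) / ?a h * (1 / (?d * h + 2)))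
      \<longlongrightarrow> - (\<integral>x. L x \<partial>\<mu>) * (1 / (?d * 0 + 2))) (at_right 0)"
    by (intro tendsto_intros) auto
  moreover have "\<forall>\<^sub>F h in at_right 0.
      ((\<integral>x. exp (- ?a h * L x) \<partial>\<mu>) - 1) / ?a h * (1 / (?d * h + 2)) = \<kappa> h"
    using eventually_at_right_less[of 0]
  proof eventually_elim
    case (elim h)
    then have "?d * h + 2 \<noteq> 0" by (metis add_nonneg_pos less_irrefl mult_nonneg_nonneg of_nat_0_le_iff less_imp_le zero_less_numeral)
    then show ?case by (simp add: \<kappa>_def)
  qed
  ultimately show ?thesis by (simp add: tendsto_cong)
qed

end

section \<open>Expansion of the prefactor and conclusion\<close>

lemma C2_grad_borel:
  fixes \<phi> :: "real^'n \<Rightarrow> real"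
  assumes "C2 \<phi>"
  shows "grad \<phi> \<in> borel_measurable borel"
  using assms unfolding C2_def
  by (intro borel_measurable_continuous_onI)
     (auto simp: continuous_on_eq_continuous_at differentiable_imp_continuous_within)

lemma prefactor_expansion:
  fixes \<epsilon> :: real
  assumes \<epsilon>: "0 < \<epsilon>"
  obtains w where "(w \<longlongrightarrow> - (real CARD('n) / 2) * ln (pi * \<epsilon>)) (at_right 0)"
    and "\<forall>\<^sub>F h in at_right 0. (\<epsilon> / h) powr (2 / (real CARD('n) * h + 2)) * frakC TYPE('n::finite) (1 + h)
      = \<epsilon> / h * exp (h * w h)"
proof -
  define d where "d = real CARD('n)"
  define S where "S = sphere_area TYPE('n)"
  define A where "A h = (\<epsilon> / h) powr (2 / (d * h + 2)) * frakC TYPE('n) (1 + h)" for h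
  define q where "q h = (1 + h) * (d * h + 2) / (d * h + 2 * (1 + h))" for h
  define \<beta> where "\<beta> h = ln (Beta (1 / h + 1) (d / 2)) - d / 2 * ln h" for h
  \<comment> \<open>Obtained by solving A h = \<epsilon> / h * exp (h * w h) for w, with the terms
    in ln h already cancelled; \<open>\<beta>\<close> is the logarithm of the beta value freed of
    its singular part.\<close>
  define w where "w h = - d / (d * h + 2) * ln \<epsilon> + ln (q h) / h
    - 2 / (d * h + 2) * (d / 2 * ln (1 + h) + ln (S / 2) + \<beta> h)" for h
  have d: "0 < d" by (simp add: d_def)
  have S: "S = d * unit_ball_vol d" by (simp add: S_def sphere_area_eq d_def)
  have S0: "0 < S" using d by (simp add: S)
  \<comment> \<open>The exact area of the sphere enters here and yields the \<pi> in the
    limit.\<close>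
  have "S / 2 * Gamma (d / 2) = pi powr (d / 2)"
  proof -
    have "Gamma (d / 2 + 1) = d / 2 * Gamma (d / 2)"
      using d by (intro Gamma_plus1) (auto elim!: nonpos_Ints_cases)
    moreover have "Gamma (d / 2) \<noteq> 0" using d Gamma_real_pos[of "d / 2"] by linarith
    ultimately show ?thesis using d by (simp add: S unit_ball_vol_def field_simps)
  qed
  then have "ln (S / 2 * Gamma (d / 2)) = d / 2 * ln pi" by simp
  then have const: "ln (S / 2) + ln (Gamma (d / 2)) = d / 2 * ln pi"
    using S0 d by (subst ln_mult_pos[symmetric]) auto
  have \<beta>_lim: "(\<beta> \<longlongrightarrow> ln (Gamma (d / 2))) (at_right 0)"
    unfolding \<beta>_def using d by (intro ln_Beta_asymptotics) simp
  \<comment> \<open>The rational factor has no first order term: q h = 1 + d * h * h / (d * h + 2 *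
    (1 + h)).\<close>
  have q_lim: "((\<lambda>h. ln (q h) / h) \<longlongrightarrow> 0) (at_right 0)"
    unfolding q_def using d by real_asymp
  have "(w \<longlongrightarrow> - d / (d * 0 + 2) * ln \<epsilon> + 0
    - 2 / (d * 0 + 2) * (d / 2 * ln (1 + 0) + ln (S / 2) + ln (Gamma (d / 2)))) (at_right 0)"
    unfolding w_def by (intro tendsto_intros q_lim \<beta>_lim) auto
  moreover have "- d / (d * 0 + 2) * ln \<epsilon> + 0
    - 2 / (d * 0 + 2) * (d / 2 * ln (1 + 0) + ln (S / 2) + ln (Gamma (d / 2))) = - (d / 2) * ln (pi * \<epsilon>)"
    using const \<epsilon> by (simp add: ln_mult_pos algebra_simps)
  ultimately have "(w \<longlongrightarrow> - (d / 2) * ln (pi * \<epsilon>)) (at_right 0)" by simp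
  moreover have "\<forall>\<^sub>F h in at_right 0. A h = \<epsilon> / h * exp (h * w h)"
    using eventually_at_right_less[of 0]
  proof eventually_elim
    case (elim h)
    define m where "m = d * h + 2"
    define l where "l = ln h"
    have m: "0 < m" using elim d by (simp add: m_def add_pos_pos)
    have h1: "0 < 1 / h + 1" using elim by (intro add_pos_pos) auto
    have Bpos: "0 < Beta (1 / h + 1) (d / 2)"
      using h1 d Gamma_real_pos[of "1 / h + 1 + d / 2"] by (auto simp: Beta_def intro!: divide_pos_pos mult_pos_pos)
    define B where "B = frakB TYPE('n) (1 + h)"
    have B: "B = (1 + h) powr (d / 2) / 2 * S * Beta (1 / h + 1) (d / 2)"
      using elim by (simp add: B_def frakB_def Let_def d_def[symmetric] S_def add_divide_distrib add.commute)
    have lnB: "ln B = d / 2 * ln (1 + h) + ln (S / 2) + (\<beta> h + d / 2 * l)"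
    proof -
      have "B = (1 + h) powr (d / 2) * ((S / 2) * Beta (1 / h + 1) (d / 2))" by (simp add: B)
      also have "ln \<dots> = ln ((1 + h) powr (d / 2)) + (ln (S / 2) + ln (Beta (1 / h + 1) (d / 2)))"
      proof -
        have "0 < (1 + h) powr (d / 2)" "0 < S / 2" using elim S0 by auto
        then show ?thesis using Bpos by (simp only: ln_mult_pos mult_pos_pos)
      qed
      finally show ?thesis using elim by (simp add: \<beta>_def l_def ln_powr)
    qed
    have B0: "0 < B" using elim S0 Bpos by (simp add: B)
    have q0: "0 < q h" unfolding q_def using elim d by (intro divide_pos_pos mult_pos_pos add_pos_pos) auto
    have fC: "frakC TYPE('n) (1 + h) = q h * B powr (- (2 * h / m))"
      by (simp add: frakC_def Let_def d_def[symmetric] q_def B_def m_def)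
    have A: "A h = (\<epsilon> / h) powr (2 / m) * (q h * B powr (- (2 * h / m)))"
      by (simp add: A_def fC m_def)
    have "ln (A h) = 2 / m * ln (\<epsilon> / h) + (ln (q h) - 2 * h / m * ln B)"
      unfolding A using elim \<epsilon> q0 B0 by (simp add: ln_mult_pos ln_powr)
    \<comment> \<open>Since 2 / m = 1 - d * h / m, the power of \<epsilon> / h contributes + X * l
      and the power of the beta function - X * l, where l = ln h.\<close>
    also have "\<dots> = ln (\<epsilon> / h) + h * w h"
    proof -
      have l1: "ln (\<epsilon> / h) = ln \<epsilon> - l" using elim \<epsilon> by (simp add: ln_div l_def)
      have l2: "2 / m = 1 - d * h / m" using m by (simp add: m_def field_simps)
      define X where "X = d * h / m"
      define Y where "Y = 2 * h / m * (d / 2 * ln (1 + h) + ln (S / 2) + \<beta> h)"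
      have "h * w h = - (X * ln \<epsilon>) + ln (q h) - Y"
        using elim unfolding w_def X_def Y_def m_def[symmetric] by (simp add: algebra_simps)
      moreover have "2 / m * (ln \<epsilon> - l) = ln \<epsilon> - l - (X * ln \<epsilon> - X * l)"
        unfolding l2 X_def[symmetric] by (simp add: algebra_simps)
      moreover have "2 * h / m * (d / 2 * ln (1 + h) + ln (S / 2) + (\<beta> h + d / 2 * l)) = Y + X * l"
        unfolding X_def Y_def by (simp add: distrib_left mult_ac)
      ultimately show ?thesis unfolding l1 lnB by linarith
    qed
    finally have "exp (ln (A h)) = exp (ln (\<epsilon> / h)) * exp (h * w h)" by (simp add: exp_add)
    moreover have "0 < A h" unfolding A using elim \<epsilon> q0 B0 by simp
    ultimately show ?case using elim \<epsilon> by simp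
  qed
  ultimately show ?thesis using that unfolding A_def d_def by blast
qed

theorem lemma2p5:
  fixes \<mu> \<nu> :: "(real^'n) measure" and \<phi> :: "real^'n \<Rightarrow> real"
    and \<sigma>m \<sigma>M \<beta> \<epsilon> :: real
  assumes "\<mu> \<in> prob_moment_ac 2" and "\<nu> \<in> prob_moment_ac 2"
    and "convex_on UNIV \<phi>" and "C2 \<phi>"
    and "0 < \<sigma>m" and "\<sigma>m \<le> \<sigma>M"
    and "distr \<mu> borel (grad \<phi>) = \<nu>"
    and "\<And>y. mat \<sigma>m \<preceq> hessian \<phi> y \<and> hessian \<phi> y \<preceq> mat \<sigma>M"
    and "\<beta> > 0" and "\<mu> \<in> prob_moment (2 + \<beta>)" and "\<nu> \<in> prob_moment (2 + \<beta>)"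
    and "(\<integral>\<^sup>+ x. ennreal \<bar>ln (lebesgue_density \<mu> x)\<bar> \<partial>\<mu>)
       + (\<integral>\<^sup>+ x. ennreal \<bar>ln (lebesgue_density \<nu> x)\<bar> \<partial>\<nu>) < \<infinity>"
    and "\<epsilon> > 0"
  shows "((\<lambda>p. ereal ((\<epsilon> / (p - 1)) powr (2 / (real CARD('n) * (p - 1) + 2)) * frakC TYPE('n) p)
                 * enn2ereal (cost_K \<phi> \<mu> \<nu> p)
               - ereal (\<epsilon> / (p - 1)))
          \<longlongrightarrow> ereal (- (real CARD('n) / 2) * \<epsilon> * ln (pi * \<epsilon>) + \<epsilon> * K_EOT \<phi> \<mu> \<nu>)) (at_right 1)"
proof -
  let ?d = "real CARD('n)"
  interpret transport_pair \<mu> \<nu> "grad \<phi>" "\<lambda>x. ln (lebesgue_density \<mu> x * lebesgue_density \<nu> (grad \<phi> x))"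
    using assms C2_grad_borel by unfold_locales auto
  let ?L = "\<lambda>x. ln (lebesgue_density \<mu> x * lebesgue_density \<nu> (grad \<phi> x))"
  define K where "K h = (\<integral>x. exp (- (h / (?d * h + 2)) * ?L x) \<partial>\<mu>)" for h
  define A where "A h = (\<epsilon> / h) powr (2 / (?d * h + 2)) * frakC TYPE('n) (1 + h)" for h
  obtain w where w: "(w \<longlongrightarrow> - (?d / 2) * ln (pi * \<epsilon>)) (at_right 0)"
    and Aw: "\<forall>\<^sub>F h in at_right 0. A h = \<epsilon> / h * exp (h * w h)"
    unfolding A_def using prefactor_expansion[OF \<open>\<epsilon> > 0\<close>, where 'n = 'n] by blast
  have \<kappa>: "(\<kappa> \<longlongrightarrow> K_EOT \<phi> \<mu> \<nu>) (at_right 0)"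
    using \<kappa>_tendsto by (simp add: K_EOT_def)
  have "\<forall>\<^sub>F h in at_right 0. K h = 1 + h * \<kappa> h"
    using eventually_at_right_less[of 0] by eventually_elim (simp add: \<kappa>_def K_def)
  from tendsto_renormalized_product[OF w \<kappa> Aw this]
  have "((\<lambda>h. ereal (A h * K h - \<epsilon> / h)) \<longlongrightarrow> ereal (\<epsilon> * (- (?d / 2) * ln (pi * \<epsilon>) + K_EOT \<phi> \<mu> \<nu>))) (at_right 0)"
    by (intro tendsto_ereal)
  moreover have "\<forall>\<^sub>F h in at_right 0. ereal (A h * K h - \<epsilon> / h)
      = ereal (A h) * enn2ereal (cost_K \<phi> \<mu> \<nu> (1 + h)) - ereal (\<epsilon> / h)"
    \<comment> \<open>For 0 < h < \<open>a0\<close> the exponent h / (d h + 2) is at most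
      \<open>a0\<close>, so the extended-valued cost is finite and the identity can be checked among
      reals.\<close>
    using eventually_at_right_real[OF a0_pos]
  proof eventually_elim
    case (elim h)
    have "0 \<le> ?d * h" using elim by simp
    then have "0 \<le> h / (?d * h + 2)" "h / (?d * h + 2) \<le> h / 1"
      using elim by (auto intro!: frac_le simp del: div_by_1)
    then have "cost_K \<phi> \<mu> \<nu> (1 + h) = ennreal (K h)"
      using nn_integral_powr_eq[of "h / (?d * h + 2)"] elim by (simp add: cost_K_def K_def Let_def)
    moreover have "0 \<le> K h" unfolding K_def by (intro Bochner_Integration.integral_nonneg) auto
    ultimately show ?case by simp
  qed
  ultimately have "((\<lambda>h. ereal (A h) * enn2ereal (cost_K \<phi> \<mu> \<nu> (1 + h)) - ereal (\<epsilon> / h))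
      \<longlongrightarrow> ereal (\<epsilon> * (- (?d / 2) * ln (pi * \<epsilon>) + K_EOT \<phi> \<mu> \<nu>))) (at_right 0)"
    by (rule Lim_transform_eventually)
  moreover have "\<epsilon> * (- (?d / 2) * ln (pi * \<epsilon>) + K_EOT \<phi> \<mu> \<nu>)
      = - (?d / 2) * \<epsilon> * ln (pi * \<epsilon>) + \<epsilon> * K_EOT \<phi> \<mu> \<nu>"
    by (simp add: algebra_simps)
  ultimately show ?thesis
    unfolding filterlim_at_right_to_0[of _ _ 1] A_def by (simp add: add.commute)
qed

end
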